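(* Let $n\ge 2$ and let $a_1,a_2,\ldots,a_n\ge 2$ be pairwise relatively prime integers. Put $\alpha:=a_1a_2\cdots a_{n-1}$. Then the $d$-invariants of the two Seifert fibered integral homology spheres $$\Sigma(a_1,a_2,\dots,a_{n-1},a_n)\qquad\text{and}\qquad \Sigma(a_1,a_2,\dots,a_{n-1},a_n+\alpha)$$ are equal.
   Context: **Seifert homology spheres.** For pairwise coprime integers $a_1,\dots,a_n\ge 2$, let $(e_0,b_1,\dots,b_n)$ be the unique integers with $1\le b_i<a_i$ for all $i$ and $$\sum_{i=1}^n \frac{b_i}{a_i}\Big(\prod_{j=1}^n a_j\Big)=-1-e_0a_1a_2\cdots a_n .$$ One has $e_0<0$. The Seifert homology sphere $\Sigma(a_1,\dots,a_n)$ is the Seifert manifold $M(e_0,(a_1,b_1),\dots,(a_n,b_n))$ over $S^2$. It is given by the rational surgery diagram with a central unknot of framing $e_0$ and $n$ meridional unknots with coefficients $-a_i/b_i$. Write $a_i/b_i=[x_{i,1},\dots,x_{i,m_i}]=x_{i,1}-\cfrac{1}{x_{i,2}-\cdots}$ with all $x_{i,j}\ge 2$. Then $\Sigma(a_1,\dots,a_n)$ is the boundary of the plumbing on the negative-definite star-shaped tree $\Gamma$ with a central vertex decorated $e_0$ and $n$ legs, where the $i$-th leg has vertices decorated, going outwards from the centre, by $-x_{i,1},\dots,-x_{i,m_i}$. **Lattice homology.** Let $\Gamma$ be a negative-definite plumbing tree with vertices $v_1,\dots,v_N$, and write $|\Gamma|=N$. Let $L=\mathrm{Span}_{\mathbb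 Z}(v_1,\dots,v_N)$ with the bilinear form $(v_i,v_i)=$ decoration of $v_i$, $(v_i,v_j)=1$ if $v_i,v_j$ are distinct and adjacent, and $(v_i,v_j)=0$ otherwise. Extend this form to $L\otimes\mathbb Q$. A characteristic vector is $k\in L\otimes\mathbb Q$ with $(k,x)\equiv(x,x)\pmod 2$ for all $x\in L$. Two characteristic vectors are equivalent if they differ by an element of $2L$; for an integral homology sphere there is only one class. Fix a characteristic vector $k$ and put $w(x)=\frac{(x,x)+(k,x)}{2}$ for $x\in L$. For a unit lattice cube (of any dimension $\ge 0$, with vertices in $L$ and edges parallel to the $v_i$) let its weight be the minimum of $w$ over its vertices. Let $S_m$ ($m\in\mathbb Z$) be the union of all such cubes of weight $\ge m$, so that $S_{m+1}\subseteq S_m$. The graded root has one vertex at height $-2m$ for each connected component of $S_m$, and an edge joining each component of $S_{m+1}$ to the component of $S_m$ containing it. The lattice homology is this graded root with all heights shifted by $-\frac{(k,k)+|\Gamma|}{4}$. The shifted height of a vertex is its grading. The result does not depend on the choice of $k$ in its class, nor on the plumbing graph chosen for the manifold. **$d$-invariant.** The $d$-invariant of the manifold is $-1$ times the grading of the lowest vertex of its lattice homology. *)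

theory Defs
  imports "HOL-Analysis.Analysis"
begin

record 'v plumbing =
  verts :: "'v set"
  adj :: "'v \<Rightarrow> 'v \<Rightarrow> bool"
  decor :: "'v \<Rightarrow> int"

text \<open>The lattice of a plumbing graph consists of the integral functions on the vertices (extended
  by zero), and its rationalisation of the rational ones.\<close>

definition lattice_of :: "('v, 'z) plumbing_scheme \<Rightarrow> ('v \<Rightarrow> int) set" where
  "lattice_of \<Gamma> = {x. \<forall>v. v \<notin> verts \<Gamma> \<longrightarrow> x v = 0}"

definition rat_lattice_of :: "('v, 'z) plumbing_scheme \<Rightarrow> ('v \<Rightarrow> rat) set" where
  "rat_lattice_of \<Gamma> = {x. \<forall>v. v \<notin> verts \<Gamma> \<longrightarrow> x v = 0}"

definition pairing :: "('v, 'z) plumbing_scheme \<Rightarrow> 'v \<Rightarrow> 'v \<Rightarrow> int" where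
  "pairing \<Gamma> u v = (if u = v then decor \<Gamma> u else if adj \<Gamma> u v then 1 else 0)"

definition form :: "('v, 'z) plumbing_scheme \<Rightarrow> ('v \<Rightarrow> rat) \<Rightarrow> ('v \<Rightarrow> rat) \<Rightarrow> rat" where
  "form \<Gamma> x y = (\<Sum>u\<in>verts \<Gamma>. \<Sum>v\<in>verts \<Gamma>. x u * y v * of_int (pairing \<Gamma> u v))"

abbreviation to_rat :: "('v \<Rightarrow> int) \<Rightarrow> 'v \<Rightarrow> rat" where
  "to_rat x \<equiv> (\<lambda>v. rat_of_int (x v))"

definition characteristic :: "('v, 'z) plumbing_scheme \<Rightarrow> ('v \<Rightarrow> rat) \<Rightarrow> bool" where
  "characteristic \<Gamma> k \<longleftrightarrow> k \<in> rat_lattice_of \<Gamma> \<and>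
     (\<forall>x\<in>lattice_of \<Gamma>. \<exists>t::int.
        form \<Gamma> k (to_rat x) - form \<Gamma> (to_rat x) (to_rat x) = 2 * of_int t)"

definition weight :: "('v, 'z) plumbing_scheme \<Rightarrow> ('v \<Rightarrow> rat) \<Rightarrow> ('v \<Rightarrow> int) \<Rightarrow> rat" where
  "weight \<Gamma> k x = (form \<Gamma> (to_rat x) (to_rat x) + form \<Gamma> k (to_rat x)) / 2"

text \<open>The unit cube with lowest corner \<open>x\<close> and edge directions \<open>I\<close>, as a subset of the real
  vector space spanned by the vertices. For a finite graph the product topology on
  \<open>'v \<Rightarrow> real\<close> induces the Euclidean topology on that space.\<close>

definition cube :: "('v \<Rightarrow> int) \<Rightarrow> 'v set \<Rightarrow> ('v \<Rightarrow> real) set" where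
  "cube x I = {y. \<forall>v. of_int (x v) \<le> y v \<and> y v \<le> of_int (x v) + (if v \<in> I then 1 else 0)}"

definition cube_corners :: "('v \<Rightarrow> int) \<Rightarrow> 'v set \<Rightarrow> ('v \<Rightarrow> int) set" where
  "cube_corners x I = (\<lambda>J v. x v + (if v \<in> J then 1 else 0)) ` Pow I"

definition cube_weight ::
    "('v, 'z) plumbing_scheme \<Rightarrow> ('v \<Rightarrow> rat) \<Rightarrow> ('v \<Rightarrow> int) \<Rightarrow> 'v set \<Rightarrow> rat" where
  "cube_weight \<Gamma> k x I = Min (weight \<Gamma> k ` cube_corners x I)"

definition superlevel ::
    "('v, 'z) plumbing_scheme \<Rightarrow> ('v \<Rightarrow> rat) \<Rightarrow> int \<Rightarrow> ('v \<Rightarrow> real) set" where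
  "superlevel \<Gamma> k m =
     \<Union> {cube x I | x I. x \<in> lattice_of \<Gamma> \<and> I \<subseteq> verts \<Gamma> \<and> cube_weight \<Gamma> k x I \<ge> of_int m}"

record 'r graded_root =
  root_verts :: "'r set"
  root_edges :: "'r set set"
  grading :: "'r \<Rightarrow> rat"

text \<open>A vertex of the graded root is a pair of a level \<open>m\<close> and a component of \<open>superlevel \<Gamma> k m\<close>,
  since the same set may be a component at several levels.\<close>

definition unshifted_root ::
    "('v, 'z) plumbing_scheme \<Rightarrow> ('v \<Rightarrow> rat) \<Rightarrow> (int \<times> ('v \<Rightarrow> real) set) graded_root" where
  "unshifted_root \<Gamma> k =
     \<lparr> root_verts = {(m, C). C \<in> components (superlevel \<Gamma> k m)},
       root_edges = {{(m + 1, C), (m, D)} | m C D.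
          C \<in> components (superlevel \<Gamma> k (m + 1)) \<and> D \<in> components (superlevel \<Gamma> k m) \<and> C \<subseteq> D},
       grading = (\<lambda>(m, C). of_int (- 2 * m)) \<rparr>"

definition shift_root :: "rat \<Rightarrow> 'r graded_root \<Rightarrow> 'r graded_root" where
  "shift_root s R = R \<lparr> grading := (\<lambda>r. grading R r + s) \<rparr>"

definition lattice_homology ::
    "('v, 'z) plumbing_scheme \<Rightarrow> ('v \<Rightarrow> rat) \<Rightarrow> (int \<times> ('v \<Rightarrow> real) set) graded_root" where
  "lattice_homology \<Gamma> k =
     shift_root (- (form \<Gamma> k k + of_nat (card (verts \<Gamma>))) / 4) (unshifted_root \<Gamma> k)"

definition lowest_grading :: "'r graded_root \<Rightarrow> rat" where
  "lowest_grading R = (LEAST g. g \<in> grading R ` root_verts R)"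

text \<open>Only meaningful for the plumbing of an integral homology sphere: there all characteristic
  vectors are equivalent, so the value does not depend on the one chosen.\<close>

definition d_invariant :: "('v, 'z) plumbing_scheme \<Rightarrow> rat" where
  "d_invariant \<Gamma> = - lowest_grading (lattice_homology \<Gamma> (SOME k. characteristic \<Gamma> k))"

fun neg_cont_frac :: "int list \<Rightarrow> rat" where
  "neg_cont_frac [] = 0"
| "neg_cont_frac [x] = of_int x"
| "neg_cont_frac (x # y # xs) = of_int x - 1 / neg_cont_frac (y # xs)"

definition neg_expansion :: "rat \<Rightarrow> int list" where
  "neg_expansion q = (THE xs. xs \<noteq> [] \<and> (\<forall>x\<in>set xs. 2 \<le> x) \<and> neg_cont_frac xs = q)"

datatype star_vertex = Centre | Leg nat nat

fun star_adj :: "star_vertex \<Rightarrow> star_vertex \<Rightarrow> bool" where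
  "star_adj Centre Centre = False"
| "star_adj Centre (Leg i j) = (j = 1)"
| "star_adj (Leg i j) Centre = (j = 1)"
| "star_adj (Leg i j) (Leg i' j') = (i = i' \<and> (j' = j + 1 \<or> j = j' + 1))"

text \<open>The star with legs \<open>1, \<dots>, n\<close>, the \<open>i\<close>-th one decorated by the negatives of \<open>xs i\<close>, going
  outwards from the centre; \<open>Leg i j\<close> is its \<open>j\<close>-th vertex, counted from 1.\<close>

definition star_plumbing :: "int \<Rightarrow> nat \<Rightarrow> (nat \<Rightarrow> int list) \<Rightarrow> star_vertex plumbing" where
  "star_plumbing e\<^sub>0 n xs =
     \<lparr> verts = insert Centre {Leg i j | i j. i \<in> {1..n} \<and> j \<in> {1..length (xs i)}},
       adj = star_adj,
       decor = (\<lambda>v. case v of Centre \<Rightarrow> e\<^sub>0 | Leg i j \<Rightarrow> - (xs i ! (j - 1))) \<rparr>"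

definition is_seifert_data :: "nat \<Rightarrow> (nat \<Rightarrow> int) \<Rightarrow> int \<Rightarrow> (nat \<Rightarrow> int) \<Rightarrow> bool" where
  "is_seifert_data n a e\<^sub>0 b \<longleftrightarrow>
     b \<in> (\<Pi>\<^sub>E i\<in>{1..n}. {1..<a i}) \<and>
     (\<Sum>i=1..n. rat_of_int (b i) / rat_of_int (a i)) * of_int (\<Prod>j=1..n. a j)
       = - 1 - of_int e\<^sub>0 * of_int (\<Prod>j=1..n. a j)"

definition seifert_data :: "nat \<Rightarrow> (nat \<Rightarrow> int) \<Rightarrow> int \<times> (nat \<Rightarrow> int)" where
  "seifert_data n a = (THE p. is_seifert_data n a (fst p) (snd p))"

definition seifert_plumbing :: "nat \<Rightarrow> (nat \<Rightarrow> int) \<Rightarrow> star_vertex plumbing" where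
  "seifert_plumbing n a =
     (let (e\<^sub>0, b) = seifert_data n a
      in star_plumbing e\<^sub>0 n (\<lambda>i. neg_expansion (of_int (a i) / of_int (b i))))"

text \<open>The $d$-invariant of the Seifert homology sphere with multiplicities \<open>a 1, \<dots>, a n\<close>.\<close>

definition d_Sigma :: "nat \<Rightarrow> (nat \<Rightarrow> int) \<Rightarrow> rat" where
  "d_Sigma n a = d_invariant (seifert_plumbing n a)"

end

theory Submission
  imports Defs
begin

text \<open>The \<open>d\<close>-invariant is the maximum of \<open>(\<kappa>\<^sup>2 + |\<Gamma>|) / 4\<close> over all characteristic vectors \<open>\<kappa>\<close>.
  If \<open>b'\<close> belongs to \<open>a\<^sub>n' = a\<^sub>n + \<alpha>\<close>, then \<open>e\<^sub>0\<close> and the other \<open>b\<^sub>i\<close> are unchanged and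
  \<open>a\<^sub>n b' - b\<^sub>n a\<^sub>n' = 1\<close>, so \<open>a\<^sub>n / b\<^sub>n\<close> is the last but one convergent of \<open>a\<^sub>n' / b'\<close>: the second
  plumbing graph is the first one with a vertex added at the end of the \<open>n\<close>-th leg. As the first
  lattice is unimodular, it is an orthogonal summand of the second, with complement \<open>\<langle>-1\<rangle>\<close>, and a
  characteristic vector has an odd coefficient there. The complement therefore contributes at most
  \<open>- 1\<close> to \<open>\<kappa>\<^sup>2\<close>, with equality attained, and this cancels the additional vertex.\<close>

section \<open>Characteristic vectors of definite unimodular plumbings\<close>

text \<open>Where the two arithmetic inputs come from: read modulo a_n, the Seifert equation says
  that a_n divides \<alpha> b_n + 1. With c the quotient, b' = b_n + c satisfies a_n b' - b_n (a_n +
  \<alpha>) = a_n c - \<alpha> b_n = 1. The generator of the complement must pair to 0 with all old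
  vertices, which along a leg is the recurrence of the continued fraction. On the n-th leg the
  difference of the numerator sequences of the two expansions solves it; its value at the centre is
  \<alpha>, divisible by every other a_i, so the remaining legs can be filled with integral
  multiples of their own numerators. Definiteness and unimodularity are obtained without
  determinants: the former from a positive vector with nonpositive pairing with every vertex, the
  latter by showing that a rational vector with integral pairings is integral.\<close>

definition vertex_pairing :: "('v, 'z) plumbing_scheme \<Rightarrow> ('v \<Rightarrow> rat) \<Rightarrow> 'v \<Rightarrow> rat" where
  "vertex_pairing \<Gamma> x v = (\<Sum>u\<in>verts \<Gamma>. x u * of_int (pairing \<Gamma> u v))"

definition neg_definite :: "('v, 'z) plumbing_scheme \<Rightarrow> bool" where
  "neg_definite \<Gamma> \<longleftrightarrow> (\<forall>x\<in>rat_lattice_of \<Gamma>. x \<noteq> (\<lambda>_. 0) \<longrightarrow> form \<Gamma> x x < 0)"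

text \<open>Stated through the dual lattice rather than a determinant: in this form the property can
  be tested coordinate by coordinate and passes directly to an orthogonal sum.\<close>

definition unimodular :: "('v, 'z) plumbing_scheme \<Rightarrow> bool" where
  "unimodular \<Gamma> \<longleftrightarrow>
     (\<forall>x\<in>rat_lattice_of \<Gamma>. (\<forall>v\<in>verts \<Gamma>. vertex_pairing \<Gamma> x v \<in> \<int>) \<longrightarrow> (\<forall>v. x v \<in> \<int>))"

text \<open>Off-diagonal terms come in equal pairs, and \<open>x a * (x a - 1)\<close> is even.
  Hence a vector whose pairing with each vertex is that vertex's decoration is
  characteristic.\<close>

lemma even_quadratic_minus_diagonal:
  fixes p :: "'a \<Rightarrow> 'a \<Rightarrow> int"
  assumes "finite A" "\<And>u v. u \<in> A \<Longrightarrow> v \<in> A \<Longrightarrow> p u v = p v u"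
  shows "even ((\<Sum>u\<in>A. \<Sum>v\<in>A. x u * x v * p u v) - (\<Sum>u\<in>A. x u * p u u))"
  using assms
proof (induction A rule: finite_induct)
  case (insert a A)
  have sym: "(\<Sum>u\<in>A. x u * x a * p u a) = (\<Sum>u\<in>A. x a * x u * p a u)"
    by (rule sum.cong) (use insert.prems in \<open>auto simp: mult_ac\<close>)
  let ?Q = "\<Sum>u\<in>A. \<Sum>v\<in>A. x u * x v * p u v"
  let ?D = "\<Sum>u\<in>A. x u * p u u"
  let ?R = "\<Sum>u\<in>A. x a * x u * p a u"
  have "(\<Sum>u\<in>insert a A. \<Sum>v\<in>insert a A. x u * x v * p u v) = x a * x a * p a a + ?R + (?R + ?Q)"
    unfolding sum.insert[OF insert.hyps] sum.distrib sym ..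
  moreover have "(\<Sum>u\<in>insert a A. x u * p u u) = x a * p a a + ?D"
    by (rule sum.insert[OF insert.hyps])
  ultimately have "(\<Sum>u\<in>insert a A. \<Sum>v\<in>insert a A. x u * x v * p u v) - (\<Sum>u\<in>insert a A. x u * p u u)
      = (?Q - ?D) + 2 * ?R + (x a * (x a - 1)) * p a a"
    by (simp only: algebra_simps)
  moreover have "even (x a * (x a - 1))" "even (?Q - ?D)"
    using insert by auto
  ultimately show ?case
    by (simp only: even_add even_mult_iff) simp
qed simp

section \<open>The bilinear form of a plumbing graph\<close>

locale plumbing_lattice =
  fixes \<Gamma> :: "('v, 'z) plumbing_scheme"
  assumes finite_verts: "finite (verts \<Gamma>)"
    and pairing_sym: "u \<in> verts \<Gamma> \<Longrightarrow> v \<in> verts \<Gamma> \<Longrightarrow> pairing \<Gamma> u v = pairing \<Gamma> v u"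
begin

lemma form_eq_sum_right: "form \<Gamma> x y = (\<Sum>v\<in>verts \<Gamma>. y v * vertex_pairing \<Gamma> x v)"
  unfolding form_def vertex_pairing_def
  by (subst sum.swap) (simp add: sum_distrib_left mult_ac)

lemma form_sym: "form \<Gamma> x y = form \<Gamma> y x"
  unfolding form_def
  by (subst sum.swap) (intro sum.cong refl, simp add: pairing_sym mult_ac)

lemma form_eq_sum_left: "form \<Gamma> x y = (\<Sum>v\<in>verts \<Gamma>. x v * vertex_pairing \<Gamma> y v)"
  by (subst form_sym) (rule form_eq_sum_right)

lemma vertex_pairing_add:
  "vertex_pairing \<Gamma> (\<lambda>v. x v + y v) u = vertex_pairing \<Gamma> x u + vertex_pairing \<Gamma> y u"
  by (simp add: vertex_pairing_def sum.distrib algebra_simps)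

lemma vertex_pairing_scale: "vertex_pairing \<Gamma> (\<lambda>v. c * x v) u = c * vertex_pairing \<Gamma> x u"
  by (simp add: vertex_pairing_def sum_distrib_left mult_ac)

lemma form_add_right: "form \<Gamma> x (\<lambda>v. y v + z v) = form \<Gamma> x y + form \<Gamma> x z"
  by (simp add: form_eq_sum_right sum.distrib algebra_simps)

lemma form_scale_right: "form \<Gamma> x (\<lambda>v. c * y v) = c * form \<Gamma> x y"
  by (simp add: form_eq_sum_right sum_distrib_left mult_ac)

lemma form_add_left: "form \<Gamma> (\<lambda>v. x v + y v) z = form \<Gamma> x z + form \<Gamma> y z"
  by (subst (1 2 3) form_sym) (rule form_add_right)

lemma form_scale_left: "form \<Gamma> (\<lambda>v. c * x v) y = c * form \<Gamma> x y"
  by (subst (1 2) form_sym) (rule form_scale_right)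

lemmas form_linear = form_add_right form_scale_right form_add_left form_scale_left

text \<open>Gram-Schmidt instead of an inverse matrix. When \<open>A\<close> grows by
  \<open>a\<close>, the vertex \<open>a\<close> is corrected to a vector \<open>w\<close> orthogonal
  to \<open>A\<close>; then (w, w) = (w, a) is nonzero by definiteness, so a multiple of
  \<open>w\<close> adjusts the value at \<open>a\<close> without disturbing those on
  \<open>A\<close>.\<close>

lemma functional_representable:
  assumes "neg_definite \<Gamma>"
  shows "\<exists>k\<in>rat_lattice_of \<Gamma>. \<forall>v\<in>verts \<Gamma>. vertex_pairing \<Gamma> k v = c v"
proof -
  have "\<exists>k. (\<forall>v. v \<notin> A \<longrightarrow> k v = 0) \<and> (\<forall>v\<in>A. vertex_pairing \<Gamma> k v = c v)"
    if "finite A" "A \<subseteq> verts \<Gamma>" for A c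
    using that
  proof (induction A arbitrary: c rule: finite_induct)
    case (insert a A)
    define e where "e = (\<lambda>v. if v = a then 1 else 0 :: rat)"
    obtain f where f: "\<And>v. v \<notin> A \<Longrightarrow> f v = 0"
      "\<And>v. v \<in> A \<Longrightarrow> vertex_pairing \<Gamma> f v = - vertex_pairing \<Gamma> e v"
      using insert.IH[of "\<lambda>v. - vertex_pairing \<Gamma> e v"] insert.prems by auto
    define w where "w = (\<lambda>v. e v + f v)"
    have w0: "w v = 0" if "v \<notin> insert a A" for v
      using that f by (auto simp: w_def e_def)
    have wa: "w a = 1"
      using f insert.hyps by (simp add: w_def e_def)
    have pw: "vertex_pairing \<Gamma> w v = 0" if "v \<in> A" for v
      using f(2)[OF that] by (simp add: w_def vertex_pairing_add)
    have "form \<Gamma> w w = (\<Sum>v\<in>{a}. w v * vertex_pairing \<Gamma> w v)"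
      unfolding form_eq_sum_right
      by (rule sum.mono_neutral_right) (use finite_verts insert.prems w0 pw in auto)
    moreover have "w \<in> rat_lattice_of \<Gamma>" "w \<noteq> (\<lambda>_. 0)"
      using w0 insert.prems wa by (fastforce simp: rat_lattice_of_def, metis zero_neq_one)
    ultimately have nz: "vertex_pairing \<Gamma> w a \<noteq> 0"
      using assms wa by (force simp: neg_definite_def)
    obtain k where k: "\<And>v. v \<notin> A \<Longrightarrow> k v = 0" "\<And>v. v \<in> A \<Longrightarrow> vertex_pairing \<Gamma> k v = c v"
      using insert.IH[of c] insert.prems by auto
    define s where "s = (c a - vertex_pairing \<Gamma> k a) / vertex_pairing \<Gamma> w a"
    have "vertex_pairing \<Gamma> (\<lambda>v. k v + s * w v) v = c v" if "v \<in> insert a A" for v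
      using that k(2) pw nz unfolding vertex_pairing_add vertex_pairing_scale by (auto simp: s_def)
    then show ?case
      using k(1) w0 by (intro exI[of _ "\<lambda>v. k v + s * w v"]) auto
  qed auto
  from this[OF finite_verts order_refl] show ?thesis
    by (auto simp: rat_lattice_of_def)
qed

text \<open>Guarantees that the \<open>SOME\<close> in \<open>d_invariant\<close> picks a
  characteristic vector; the witness is dual to the decorations.\<close>

lemma characteristic_exists:
  assumes "neg_definite \<Gamma>"
  shows "\<exists>k. characteristic \<Gamma> k"
proof -
  obtain k where k: "k \<in> rat_lattice_of \<Gamma>"
    "\<And>v. v \<in> verts \<Gamma> \<Longrightarrow> vertex_pairing \<Gamma> k v = of_int (pairing \<Gamma> v v)"
    using functional_representable[OF assms, of "\<lambda>v. of_int (pairing \<Gamma> v v)"] by auto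
  have "\<exists>t::int. form \<Gamma> k (to_rat x) - form \<Gamma> (to_rat x) (to_rat x) = 2 * of_int t" for x
  proof -
    have "even ((\<Sum>u\<in>verts \<Gamma>. \<Sum>v\<in>verts \<Gamma>. x u * x v * pairing \<Gamma> u v)
        - (\<Sum>u\<in>verts \<Gamma>. x u * pairing \<Gamma> u u))"
      by (rule even_quadratic_minus_diagonal) (auto simp: finite_verts pairing_sym)
    then obtain t where t: "(\<Sum>u\<in>verts \<Gamma>. \<Sum>v\<in>verts \<Gamma>. x u * x v * pairing \<Gamma> u v)
        - (\<Sum>u\<in>verts \<Gamma>. x u * pairing \<Gamma> u u) = 2 * t" by blast
    have "form \<Gamma> k (to_rat x) = of_int (\<Sum>u\<in>verts \<Gamma>. x u * pairing \<Gamma> u u)"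
      unfolding form_eq_sum_right by (simp add: k)
    moreover have "form \<Gamma> (to_rat x) (to_rat x)
        = of_int (\<Sum>u\<in>verts \<Gamma>. \<Sum>v\<in>verts \<Gamma>. x u * x v * pairing \<Gamma> u v)"
      unfolding form_def by simp
    ultimately have "form \<Gamma> k (to_rat x) - form \<Gamma> (to_rat x) (to_rat x) = of_int (- (2 * t))"
      unfolding t[symmetric] by simp
    then show ?thesis
      by (intro exI[of _ "- t"]) simp
  qed
  with k(1) show ?thesis
    by (auto simp: characteristic_def)
qed

text \<open>Paired with a vertex v, both vectors give (v, v) modulo 2, so half their difference has
  integral pairings and is integral by unimodularity. This is the uniqueness of the class of
  characteristic vectors.\<close>

lemma characteristic_diff:
  assumes "unimodular \<Gamma>" "characteristic \<Gamma> k" "characteristic \<Gamma> \<kappa>"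
  shows "\<exists>x\<in>lattice_of \<Gamma>. \<kappa> = (\<lambda>v. k v + 2 * of_int (x v))"
proof -
  define z where "z = (\<lambda>v. (1/2) * (\<kappa> v + (-1) * k v))"
  have supp: "k v = 0" "\<kappa> v = 0" if "v \<notin> verts \<Gamma>" for v
    using assms that by (auto simp: characteristic_def rat_lattice_of_def)
  have "vertex_pairing \<Gamma> z v \<in> \<int>" if v: "v \<in> verts \<Gamma>" for v
  proof -
    define e where "e = (\<lambda>u. if u = v then 1 else 0 :: int)"
    have e: "form \<Gamma> y (to_rat e) = vertex_pairing \<Gamma> y v" for y
    proof -
      have "form \<Gamma> y (to_rat e) = (\<Sum>u\<in>{v}. to_rat e u * vertex_pairing \<Gamma> y u)"
        unfolding form_eq_sum_right
        by (rule sum.mono_neutral_right) (use finite_verts v in \<open>auto simp: e_def\<close>)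
      then show ?thesis by (simp add: e_def)
    qed
    have "e \<in> lattice_of \<Gamma>"
      using v by (auto simp: e_def lattice_of_def)
    then obtain t s :: int where
      "form \<Gamma> k (to_rat e) - form \<Gamma> (to_rat e) (to_rat e) = 2 * of_int t"
      "form \<Gamma> \<kappa> (to_rat e) - form \<Gamma> (to_rat e) (to_rat e) = 2 * of_int s"
      using assms(2,3) unfolding characteristic_def by blast
    moreover have "form \<Gamma> z (to_rat e) = (1/2) * (form \<Gamma> \<kappa> (to_rat e) + (-1) * form \<Gamma> k (to_rat e))"
      unfolding z_def form_add_left form_scale_left ..
    ultimately have "form \<Gamma> z (to_rat e) = of_int (s - t)"
      by simp
    then show ?thesis
      by (simp add: e)
  qed
  moreover have "z \<in> rat_lattice_of \<Gamma>"
    using supp by (simp add: z_def rat_lattice_of_def)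
  ultimately have "z v \<in> \<int>" for v
    using assms(1) by (auto simp: unimodular_def)
  then have x: "of_int \<lfloor>z v\<rfloor> = z v" for v
    by simp
  show ?thesis
  proof (intro bexI[of _ "\<lambda>v. \<lfloor>z v\<rfloor>"] ext)
    show "\<kappa> v = k v + 2 * of_int \<lfloor>z v\<rfloor>" for v
      unfolding x by (simp add: z_def field_simps)
    show "(\<lambda>v. \<lfloor>z v\<rfloor>) \<in> lattice_of \<Gamma>"
      using supp by (simp add: lattice_of_def z_def)
  qed
qed

section \<open>Weights, superlevel sets and squares of characteristic vectors\<close>

lemma characteristic_shift:
  assumes "characteristic \<Gamma> k" "x \<in> lattice_of \<Gamma>"
  shows "characteristic \<Gamma> (\<lambda>v. k v + 2 * of_int (x v))"
proof -
  have "\<exists>t::int. form \<Gamma> (\<lambda>v. k v + 2 * of_int (x v)) (to_rat y) - form \<Gamma> (to_rat y) (to_rat y)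
      = 2 * of_int t" if y: "y \<in> lattice_of \<Gamma>" for y
  proof -
    obtain t :: int where t: "form \<Gamma> k (to_rat y) - form \<Gamma> (to_rat y) (to_rat y) = 2 * of_int t"
      using assms(1) y by (auto simp: characteristic_def)
    obtain s :: int where "form \<Gamma> (to_rat x) (to_rat y) = of_int s"
    proof
      show "form \<Gamma> (to_rat x) (to_rat y)
          = of_int (\<Sum>u\<in>verts \<Gamma>. \<Sum>v\<in>verts \<Gamma>. x u * y v * pairing \<Gamma> u v)"
        by (simp add: form_def)
    qed
    with t show ?thesis
      unfolding form_linear by (intro exI[of _ "t + s"]) (simp add: algebra_simps)
  qed
  moreover have "(\<lambda>v. k v + 2 * of_int (x v)) \<in> rat_lattice_of \<Gamma>"
    using assms by (auto simp: characteristic_def rat_lattice_of_def lattice_of_def)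
  ultimately show ?thesis
    by (simp add: characteristic_def)
qed

text \<open>Completing the square: within one class, maximising the weight amounts to maximising the
  square of a characteristic vector.\<close>

lemma form_shift:
  "form \<Gamma> (\<lambda>v. k v + 2 * of_int (x v)) (\<lambda>v. k v + 2 * of_int (x v))
     = form \<Gamma> k k + 8 * weight \<Gamma> k x"
proof -
  have "form \<Gamma> (to_rat x) k = form \<Gamma> k (to_rat x)"
    by (rule form_sym)
  then show ?thesis
    unfolding form_linear weight_def by (simp add: field_simps)
qed

text \<open>Levels of the root are integers, so integrality makes the highest nonempty level equal
  to the maximal weight, with no loss from rounding.\<close>

lemma weight_Ints:
  assumes "characteristic \<Gamma> k" "x \<in> lattice_of \<Gamma>"
  shows "weight \<Gamma> k x \<in> \<int>"
proof -
  obtain t :: int where t: "form \<Gamma> k (to_rat x) - form \<Gamma> (to_rat x) (to_rat x) = 2 * of_int t"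
    using assms by (auto simp: characteristic_def)
  have "form \<Gamma> (to_rat x) (to_rat x)
      = of_int (\<Sum>u\<in>verts \<Gamma>. \<Sum>v\<in>verts \<Gamma>. x u * x v * pairing \<Gamma> u v)"
    by (simp add: form_def)
  moreover have "weight \<Gamma> k x = form \<Gamma> (to_rat x) (to_rat x) + of_int t"
    using t by (simp add: weight_def field_simps)
  ultimately show ?thesis
    by (simp only: Ints_add Ints_of_int)
qed

text \<open>A cube weighs at most as much as its base corner (\<open>J = {}\<close> in
  \<open>cube_corners\<close>), and a single lattice point is the cube with \<open>I = {}\<close>;
  so cubes of higher dimension never create a new nonempty level.\<close>

lemma superlevel_nonempty_iff:
  "superlevel \<Gamma> k m \<noteq> {} \<longleftrightarrow> (\<exists>x\<in>lattice_of \<Gamma>. of_int m \<le> weight \<Gamma> k x)"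
proof
  assume "superlevel \<Gamma> k m \<noteq> {}"
  then obtain x I where x: "x \<in> lattice_of \<Gamma>" "I \<subseteq> verts \<Gamma>" "of_int m \<le> cube_weight \<Gamma> k x I"
    by (auto simp: superlevel_def)
  have "finite (cube_corners x I)"
    using x finite_verts by (auto simp: cube_corners_def intro: finite_subset)
  moreover have "x \<in> cube_corners x I"
    by (auto simp: cube_corners_def intro!: image_eqI[of _ _ "{}"])
  ultimately have "cube_weight \<Gamma> k x I \<le> weight \<Gamma> k x"
    by (auto simp: cube_weight_def intro!: Min_le)
  with x show "\<exists>x\<in>lattice_of \<Gamma>. of_int m \<le> weight \<Gamma> k x"
    by (intro bexI[of _ x]) simp_all
next
  assume "\<exists>x\<in>lattice_of \<Gamma>. of_int m \<le> weight \<Gamma> k x"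
  then obtain x where x: "x \<in> lattice_of \<Gamma>" "of_int m \<le> weight \<Gamma> k x"
    by blast
  have "cube_weight \<Gamma> k x {} = weight \<Gamma> k x"
    by (simp add: cube_weight_def cube_corners_def)
  moreover have "(\<lambda>v. of_int (x v)) \<in> cube x {}"
    by (simp add: cube_def)
  ultimately have "(\<lambda>v. of_int (x v)) \<in> superlevel \<Gamma> k m"
    using x unfolding superlevel_def
    by (intro UnionI[of "cube x {}"] CollectI exI[of _ x] exI[of _ "{}"]) simp_all
  then show "superlevel \<Gamma> k m \<noteq> {}"
    by blast
qed

text \<open>A nonempty superlevel set has a component and thus contributes a vertex. This reduces
  the least grading to a question about weights of lattice points.\<close>

lemma gradings_lattice_homology:
  "grading (lattice_homology \<Gamma> k) ` root_verts (lattice_homology \<Gamma> k)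
     = {- 2 * of_int m - (form \<Gamma> k k + of_nat (card (verts \<Gamma>))) / 4 | m.
          \<exists>x\<in>lattice_of \<Gamma>. of_int m \<le> weight \<Gamma> k x}"
proof -
  have "(\<exists>C. C \<in> components (superlevel \<Gamma> k m)) \<longleftrightarrow> superlevel \<Gamma> k m \<noteq> {}" for m
    using components_eq_empty[of "superlevel \<Gamma> k m"] by blast
  then have "fst ` root_verts (lattice_homology \<Gamma> k) = {m. superlevel \<Gamma> k m \<noteq> {}}"
    by (auto simp: lattice_homology_def shift_root_def unshifted_root_def image_iff)
  moreover have "grading (lattice_homology \<Gamma> k)
      = (\<lambda>m. - 2 * of_int m - (form \<Gamma> k k + of_nat (card (verts \<Gamma>))) / 4) \<circ> fst"
    by (rule ext)
      (simp add: lattice_homology_def shift_root_def unshifted_root_def split_beta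
        field_simps)
  ultimately have "grading (lattice_homology \<Gamma> k) ` root_verts (lattice_homology \<Gamma> k)
      = (\<lambda>m. - 2 * of_int m - (form \<Gamma> k k + of_nat (card (verts \<Gamma>))) / 4)
          ` {m. superlevel \<Gamma> k m \<noteq> {}}"
    by (simp only: image_comp[symmetric])
  then show ?thesis
    unfolding superlevel_nonempty_iff by blast
qed

text \<open>Gradings decrease with the level, so the least one sits at the highest nonempty level
  \<open>M\<close>, the maximal weight. \<open>form_shift\<close> turns (k, k) + 8 M into the square
  of a characteristic vector, and by \<open>characteristic_diff\<close> every characteristic vector
  is of the form considered.\<close>

lemma d_invariant_greatest:
  assumes "neg_definite \<Gamma>" "unimodular \<Gamma>"
  defines "S \<equiv> {(form \<Gamma> \<kappa> \<kappa> + of_nat (card (verts \<Gamma>))) / 4 | \<kappa>. characteristic \<Gamma> \<kappa>}"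
  shows "d_invariant \<Gamma> \<in> S" "\<And>y. y \<in> S \<Longrightarrow> y \<le> d_invariant \<Gamma>"
proof -
  define k where "k = (SOME k. characteristic \<Gamma> k)"
  have k: "characteristic \<Gamma> k"
    unfolding k_def using characteristic_exists[OF assms(1)] by (rule someI_ex)
  define W where "W = {m. \<exists>x\<in>lattice_of \<Gamma>. of_int m \<le> weight \<Gamma> k x}"
  \<comment> \<open>Definiteness makes the square of k + 2x at most 0, so by
    \<open>form_shift\<close> the weights are bounded above.\<close>
  have bound: "weight \<Gamma> k x \<le> - form \<Gamma> k k / 8" if "x \<in> lattice_of \<Gamma>" for x
  proof -
    let ?y = "\<lambda>v. k v + 2 * of_int (x v)"
    have "?y \<in> rat_lattice_of \<Gamma>"
      using characteristic_shift[OF k that] by (simp add: characteristic_def)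
    moreover have "form \<Gamma> (\<lambda>_. 0) (\<lambda>_. 0) = 0"
      by (simp add: form_def)
    ultimately have "form \<Gamma> ?y ?y \<le> 0"
      using assms(1) unfolding neg_definite_def by (metis order.order_iff_strict)
    then show ?thesis
      unfolding form_shift by simp
  qed
  obtain M where M: "M \<in> W" "\<And>m. m \<in> W \<Longrightarrow> m \<le> M"
  proof -
    have W: "m \<le> \<lfloor>- form \<Gamma> k k / 8\<rfloor>" if "m \<in> W" for m
      using that bound by (force simp: W_def le_floor_iff)
    have 0: "\<lfloor>weight \<Gamma> k (\<lambda>_. 0)\<rfloor> \<in> W"
      by (auto simp: W_def lattice_of_def intro!: bexI[of _ "\<lambda>_. 0"])
    \<comment> \<open>The highest level is found as the one at least distance below the upper bound,
      the distance being a natural number.\<close>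
    obtain M where "M \<in> W"
      "\<And>m. m \<in> W \<Longrightarrow> nat (\<lfloor>- form \<Gamma> k k / 8\<rfloor> - M) \<le> nat (\<lfloor>- form \<Gamma> k k / 8\<rfloor> - m)"
      using ex_has_least_nat[of "\<lambda>m. m \<in> W", OF 0, of "\<lambda>m. nat (\<lfloor>- form \<Gamma> k k / 8\<rfloor> - m)"] by blast
    moreover have "m \<le> M" if "m \<in> W" for m
      using calculation(2)[OF that] W[OF that] W[OF calculation(1)] by simp
    ultimately show ?thesis
      using that by blast
  qed
  have d: "d_invariant \<Gamma> = (form \<Gamma> k k + 8 * of_int M + of_nat (card (verts \<Gamma>))) / 4"
  proof -
    have "lowest_grading (lattice_homology \<Gamma> k)
        = - 2 * of_int M - (form \<Gamma> k k + of_nat (card (verts \<Gamma>))) / 4"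
      unfolding lowest_grading_def gradings_lattice_homology
    proof (rule Least_equality)
      show "- 2 * of_int M - (form \<Gamma> k k + of_nat (card (verts \<Gamma>))) / 4
          \<in> {- 2 * of_int m - (form \<Gamma> k k + of_nat (card (verts \<Gamma>))) / 4 | m.
              \<exists>x\<in>lattice_of \<Gamma>. of_int m \<le> weight \<Gamma> k x}"
        using M(1) unfolding W_def by blast
    next
      fix g :: rat
      assume "g \<in> {- 2 * of_int m - (form \<Gamma> k k + of_nat (card (verts \<Gamma>))) / 4 | m.
              \<exists>x\<in>lattice_of \<Gamma>. of_int m \<le> weight \<Gamma> k x}"
      then obtain m where "g = - 2 * of_int m - (form \<Gamma> k k + of_nat (card (verts \<Gamma>))) / 4" "m \<in> W"
        unfolding W_def by blast
      with M(2)[of m] show "- 2 * of_int M - (form \<Gamma> k k + of_nat (card (verts \<Gamma>))) / 4 \<le> g"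
        by simp
    qed
    then show ?thesis
      by (simp add: d_invariant_def k_def[symmetric] field_simps)
  qed
  obtain x where x: "x \<in> lattice_of \<Gamma>" "of_int M \<le> weight \<Gamma> k x"
    using M(1) by (auto simp: W_def)
  have le: "weight \<Gamma> k y \<le> of_int M" if "y \<in> lattice_of \<Gamma>" for y
  proof -
    obtain m where m: "weight \<Gamma> k y = of_int m"
      using weight_Ints[OF k \<open>y \<in> lattice_of \<Gamma>\<close>] by (rule Ints_cases)
    with that have "m \<in> W"
      unfolding W_def mem_Collect_eq by (intro bexI[of _ y]) auto
    with M(2) m show ?thesis
      by simp
  qed
  show "d_invariant \<Gamma> \<in> S"
    unfolding S_def mem_Collect_eq
    using characteristic_shift[OF k x(1)] x(2) le[OF x(1)]
    by (intro exI[of _ "\<lambda>v. k v + 2 * of_int (x v)"]) (simp add: d form_shift)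
  fix y assume "y \<in> S"
  then obtain \<kappa> where \<kappa>: "characteristic \<Gamma> \<kappa>"
    "y = (form \<Gamma> \<kappa> \<kappa> + of_nat (card (verts \<Gamma>))) / 4"
    by (auto simp: S_def)
  then obtain z where "z \<in> lattice_of \<Gamma>" "\<kappa> = (\<lambda>v. k v + 2 * of_int (z v))"
    using characteristic_diff[OF assms(2) k] by blast
  with le[of z] show "y \<le> d_invariant \<Gamma>"
    by (simp add: d \<kappa> form_shift)
qed

end

section \<open>Splitting off a negative unit summand\<close>

text \<open>The vector \<open>w\<close> splits off a summand \<open>\<langle>-1\<rangle>\<close>: the lattice of \<open>\<Gamma>'\<close> is the orthogonal
  sum of the lattice of \<open>\<Gamma>\<close> and of \<open>\<int> w\<close>.\<close>

locale plumbing_blowup =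
  L: plumbing_lattice \<Gamma> + L': plumbing_lattice \<Gamma>'
  for \<Gamma> \<Gamma>' :: "('v, 'z) plumbing_scheme" +
  fixes v :: 'v and w :: "'v \<Rightarrow> int"
  assumes verts_extended: "verts \<Gamma>' = insert v (verts \<Gamma>)"
    and v_new: "v \<notin> verts \<Gamma>"
    and pairing_extended:
      "u \<in> verts \<Gamma> \<Longrightarrow> u' \<in> verts \<Gamma> \<Longrightarrow> pairing \<Gamma>' u u' = pairing \<Gamma> u u'"
    and w_lattice: "w \<in> lattice_of \<Gamma>'"
    and w_new: "w v = 1"
    and w_orthogonal: "u \<in> verts \<Gamma> \<Longrightarrow> vertex_pairing \<Gamma>' (to_rat w) u = 0"
    and w_self: "vertex_pairing \<Gamma>' (to_rat w) v = - 1"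
begin

lemma vertex_pairing_extended:
  assumes "x \<in> rat_lattice_of \<Gamma>" "u \<in> verts \<Gamma>"
  shows "vertex_pairing \<Gamma>' x u = vertex_pairing \<Gamma> x u"
proof -
  have "x v = 0"
    using assms(1) v_new by (simp add: rat_lattice_of_def)
  then show ?thesis
    using L.finite_verts v_new assms(2)
    by (simp add: vertex_pairing_def verts_extended pairing_extended)
qed

lemma form_extended:
  assumes "x \<in> rat_lattice_of \<Gamma>" "y \<in> rat_lattice_of \<Gamma>"
  shows "form \<Gamma>' x y = form \<Gamma> x y"
proof -
  have "y v = 0"
    using assms(2) v_new by (simp add: rat_lattice_of_def)
  then show ?thesis
    using L.finite_verts v_new assms(1)
    by (simp add: L.form_eq_sum_right L'.form_eq_sum_right verts_extended vertex_pairing_extended)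
qed

text \<open>Orthogonality to the old vertices leaves only the coefficient at \<open>v\<close>. With
  \<open>w v = 1\<close> this gives (w, w) = -1.\<close>

lemma form_w: "form \<Gamma>' x (to_rat w) = - x v"
  using L.finite_verts v_new
  by (simp add: L'.form_eq_sum_left verts_extended w_orthogonal w_self)

lemma form_w_left: "form \<Gamma>' (to_rat w) x = - x v"
  by (subst L'.form_sym) (rule form_w)

text \<open>Because \<open>w\<close> has coefficient 1 at \<open>v\<close>, subtracting
  \<open>x v\<close> copies of it clears that coefficient. No division occurs, so integral vectors
  split integrally.\<close>

lemma split_lattice:
  assumes "x \<in> rat_lattice_of \<Gamma>'"
  obtains z where "z \<in> rat_lattice_of \<Gamma>" "x = (\<lambda>u. z u + x v * to_rat w u)"
proof
  show "(\<lambda>u. x u - x v * to_rat w u) \<in> rat_lattice_of \<Gamma>"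
    using assms w_lattice w_new
    unfolding rat_lattice_of_def lattice_of_def verts_extended
    by (intro CollectI allI impI) (rename_tac u, case_tac "u = v", auto)
qed simp

lemma form_split:
  assumes "z \<in> rat_lattice_of \<Gamma>" "y \<in> rat_lattice_of \<Gamma>"
  shows "form \<Gamma>' (\<lambda>u. z u + c * to_rat w u) (\<lambda>u. y u + d * to_rat w u) = form \<Gamma> z y - c * d"
proof -
  have "z v = 0" "y v = 0"
    using assms v_new by (auto simp: rat_lattice_of_def)
  then show ?thesis
    unfolding L'.form_linear form_w form_w_left form_extended[OF assms] by (simp add: w_new)
qed

lemma neg_definite_extended:
  assumes "neg_definite \<Gamma>"
  shows "neg_definite \<Gamma>'"
  unfolding neg_definite_def
proof (intro ballI impI)
  fix x assume x: "x \<in> rat_lattice_of \<Gamma>'" "x \<noteq> (\<lambda>_. 0)"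
  obtain z where z: "z \<in> rat_lattice_of \<Gamma>" "x = (\<lambda>u. z u + x v * to_rat w u)"
    using split_lattice[OF x(1)] by blast
  have form: "form \<Gamma>' x x = form \<Gamma> z z - x v * x v"
    by (subst (1 2) z(2)) (rule form_split[OF z(1) z(1)])
  show "form \<Gamma>' x x < 0"
  proof (cases "z = (\<lambda>_. 0)")
    case True
    with x(2) z(2) have "x v \<noteq> 0"
      by (metis add_0 mult_zero_left)
    then have "0 < x v * x v"
      using zero_less_mult_iff by fastforce
    moreover have "form \<Gamma> z z = 0"
      by (simp add: True form_def)
    ultimately show ?thesis
      by (simp add: form)
  next
    case False
    then have "form \<Gamma> z z < 0"
      using assms z(1) by (simp add: neg_definite_def)
    moreover have "0 \<le> x v * x v"
      by simp
    ultimately show ?thesis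
      unfolding form by linarith
  qed
qed

lemma unimodular_extended:
  assumes "unimodular \<Gamma>"
  shows "unimodular \<Gamma>'"
  unfolding unimodular_def
proof (intro ballI impI)
  fix x assume x: "x \<in> rat_lattice_of \<Gamma>'" "\<forall>u\<in>verts \<Gamma>'. vertex_pairing \<Gamma>' x u \<in> \<int>"
  obtain z where z: "z \<in> rat_lattice_of \<Gamma>" "x = (\<lambda>u. z u + x v * to_rat w u)"
    using split_lattice[OF x(1)] by blast
  \<comment> \<open>\<open>w\<close> is integral, so this pairing is an integer; by
    \<open>form_w\<close> it equals \<open>- x v\<close>.\<close>
  have "form \<Gamma>' x (to_rat w) \<in> \<int>"
    unfolding L'.form_eq_sum_right using x(2) by (intro Ints_sum Ints_mult) auto
  then have xv: "x v \<in> \<int>"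
    by (simp add: form_w)
  have "vertex_pairing \<Gamma> z u \<in> \<int>" if "u \<in> verts \<Gamma>" for u
  proof -
    have "vertex_pairing \<Gamma>' x u = vertex_pairing \<Gamma>' z u + x v * vertex_pairing \<Gamma>' (to_rat w) u"
      by (subst z(2)) (simp only: L'.vertex_pairing_add L'.vertex_pairing_scale)
    then have "vertex_pairing \<Gamma>' x u = vertex_pairing \<Gamma> z u"
      by (simp add: vertex_pairing_extended[OF z(1) that] w_orthogonal[OF that])
    with x(2) that show ?thesis
      by (auto simp: verts_extended)
  qed
  then have "z u \<in> \<int>" for u
    using assms z(1) by (auto simp: unimodular_def)
  with xv have "z u + x v * to_rat w u \<in> \<int>" for u
    by (intro Ints_add Ints_mult) auto
  then show "\<forall>u. x u \<in> \<int>"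
    by (subst z(2)) blast
qed

text \<open>Coefficient 1 is an odd coefficient of smallest square, so this extension attains the
  bound of \<open>characteristic_split\<close>. On the summand the required congruence is the
  evenness of c * c - c.\<close>

lemma characteristic_add_w:
  assumes "characteristic \<Gamma> k"
  shows "characteristic \<Gamma>' (\<lambda>u. k u + to_rat w u)"
  unfolding characteristic_def
proof (intro conjI ballI)
  show "(\<lambda>u. k u + to_rat w u) \<in> rat_lattice_of \<Gamma>'"
    using assms w_lattice
    by (auto simp: characteristic_def rat_lattice_of_def lattice_of_def verts_extended)
next
  fix x assume x: "x \<in> lattice_of \<Gamma>'"
  define y where "y = (\<lambda>u. x u - x v * w u)"
  have y: "y \<in> lattice_of \<Gamma>"
    using x w_lattice w_new unfolding y_def lattice_of_def verts_extended
    by (intro CollectI allI impI) (rename_tac u, case_tac "u = v", auto)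
  then have y': "to_rat y \<in> rat_lattice_of \<Gamma>"
    by (simp add: lattice_of_def rat_lattice_of_def)
  have xy: "to_rat x = (\<lambda>u. to_rat y u + of_int (x v) * to_rat w u)"
    by (simp add: y_def)
  obtain t :: int where t: "form \<Gamma> k (to_rat y) - form \<Gamma> (to_rat y) (to_rat y) = 2 * of_int t"
    using assms y by (auto simp: characteristic_def)
  obtain s where s: "x v * x v - x v = 2 * s"
  proof -
    have "even (x v * x v - x v)"
      by simp
    then show ?thesis
      using that by blast
  qed
  have k: "k \<in> rat_lattice_of \<Gamma>"
    using assms by (simp add: characteristic_def)
  have "form \<Gamma>' (\<lambda>u. k u + to_rat w u) (to_rat x) = form \<Gamma> k (to_rat y) - of_int (x v)"
    using form_split[OF k y', of 1 "of_int (x v)"] unfolding xy by simp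
  moreover have "form \<Gamma>' (to_rat x) (to_rat x)
      = form \<Gamma> (to_rat y) (to_rat y) - of_int (x v) * of_int (x v)"
    unfolding xy by (rule form_split[OF y' y'])
  moreover have "rat_of_int (x v) * of_int (x v) - of_int (x v) = 2 * of_int s"
    using arg_cong[OF s, of rat_of_int] by simp
  ultimately show "\<exists>t::int. form \<Gamma>' (\<lambda>u. k u + to_rat w u) (to_rat x)
      - form \<Gamma>' (to_rat x) (to_rat x) = 2 * of_int t"
    using t by (intro exI[of _ "t + s"]) simp
qed

lemma characteristic_split:
  assumes "characteristic \<Gamma>' \<kappa>"
  obtains k c where "characteristic \<Gamma> k" "1 \<le> c * c" "\<kappa> = (\<lambda>u. k u + c * to_rat w u)"
proof -
  have \<kappa>: "\<kappa> \<in> rat_lattice_of \<Gamma>'"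
    using assms by (simp add: characteristic_def)
  obtain k where k: "k \<in> rat_lattice_of \<Gamma>" "\<kappa> = (\<lambda>u. k u + \<kappa> v * to_rat w u)"
    using split_lattice[OF \<kappa>] by blast
  have "characteristic \<Gamma> k"
    unfolding characteristic_def
  proof (intro conjI ballI k)
    fix x assume x: "x \<in> lattice_of \<Gamma>"
    then have x': "x \<in> lattice_of \<Gamma>'" "to_rat x \<in> rat_lattice_of \<Gamma>"
      by (auto simp: lattice_of_def rat_lattice_of_def verts_extended)
    have "form \<Gamma>' \<kappa> (to_rat x) = form \<Gamma> k (to_rat x)"
      using form_split[OF k(1) x'(2), of "\<kappa> v" 0] by (subst k(2)) simp
    moreover have "form \<Gamma>' (to_rat x) (to_rat x) = form \<Gamma> (to_rat x) (to_rat x)"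
      by (rule form_extended[OF x'(2) x'(2)])
    ultimately show "\<exists>t::int. form \<Gamma> k (to_rat x) - form \<Gamma> (to_rat x) (to_rat x) = 2 * of_int t"
      using assms x'(1) unfolding characteristic_def by metis
  qed
  moreover have "1 \<le> \<kappa> v * \<kappa> v"
  proof -
    \<comment> \<open>Testing \<open>\<kappa>\<close> on \<open>w\<close> itself: with c the
      coefficient of \<open>\<kappa>\<close> at \<open>v\<close>, 1 - c is even, so c is an odd
      integer and hence nonzero.\<close>
    obtain t :: int where "form \<Gamma>' \<kappa> (to_rat w) - form \<Gamma>' (to_rat w) (to_rat w) = 2 * of_int t"
      using assms w_lattice by (auto simp: characteristic_def)
    then have c: "\<kappa> v = of_int (1 - 2 * t)"
      unfolding form_w by (simp add: w_new)
    have "0 \<noteq> 1 - 2 * t"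
      by presburger
    then have "0 < (1 - 2 * t) * (1 - 2 * t)"
      using zero_less_mult_iff[of "1 - 2 * t" "1 - 2 * t"] by linarith
    then show ?thesis
      unfolding c of_int_mult[symmetric] of_int_1_le_iff by linarith
  qed
  ultimately show ?thesis
    using that k(2) by blast
qed

theorem d_invariant_extended:
  assumes "neg_definite \<Gamma>" "unimodular \<Gamma>"
  shows "d_invariant \<Gamma> = d_invariant \<Gamma>'"
proof (rule antisym)
  note greatest = L.d_invariant_greatest[OF assms]
  note greatest' = L'.d_invariant_greatest[OF neg_definite_extended[OF assms(1)]
      unimodular_extended[OF assms(2)]]
  have card: "card (verts \<Gamma>') = Suc (card (verts \<Gamma>))"
    using L.finite_verts v_new by (simp add: verts_extended)
  obtain k where k: "characteristic \<Gamma> k"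
    "d_invariant \<Gamma> = (form \<Gamma> k k + of_nat (card (verts \<Gamma>))) / 4"
    using greatest(1) by blast
  then have k': "k \<in> rat_lattice_of \<Gamma>"
    by (simp add: characteristic_def)
  have "form \<Gamma>' (\<lambda>u. k u + to_rat w u) (\<lambda>u. k u + to_rat w u) = form \<Gamma> k k - 1"
    using form_split[OF k' k', of 1 1] by simp
  then show "d_invariant \<Gamma> \<le> d_invariant \<Gamma>'"
    using characteristic_add_w[OF k(1)] k(2)
    by (intro greatest'(2)) (auto simp: card intro!: exI[of _ "\<lambda>u. k u + to_rat w u"])
  obtain \<kappa> where \<kappa>: "characteristic \<Gamma>' \<kappa>"
    "d_invariant \<Gamma>' = (form \<Gamma>' \<kappa> \<kappa> + of_nat (card (verts \<Gamma>'))) / 4"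
    using greatest'(1) by blast
  obtain h c where h: "characteristic \<Gamma> h" "1 \<le> c * c" "\<kappa> = (\<lambda>u. h u + c * to_rat w u)"
    using characteristic_split[OF \<kappa>(1)] by blast
  have h': "h \<in> rat_lattice_of \<Gamma>"
    using h(1) by (simp add: characteristic_def)
  have "d_invariant \<Gamma>' \<le> (form \<Gamma> h h + of_nat (card (verts \<Gamma>))) / 4"
    unfolding \<kappa>(2) h(3) form_split[OF h' h'] card using h(2) by simp
  also have "\<dots> \<le> d_invariant \<Gamma>"
    using h(1) by (intro greatest(2)) blast
  finally show "d_invariant \<Gamma>' \<le> d_invariant \<Gamma>" .
qed

end

section \<open>Negative continued fractions\<close>

text \<open>If \<open>xs\<close> expands \<open>a / b\<close>, the sequence starts \<open>a, b\<close> and continues with the remainders of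
  the division algorithm with negative remainders, down to 1 at position \<open>length xs\<close>, and 0 after.\<close>

fun tail_num :: "int list \<Rightarrow> nat \<Rightarrow> int" where
  "tail_num [] 0 = 1"
| "tail_num [] (Suc j) = 0"
| "tail_num (x # xs) 0 = x * tail_num xs 0 - tail_num xs 1"
| "tail_num (x # xs) (Suc j) = tail_num xs j"

lemma tail_num_length [simp]: "tail_num xs (length xs) = 1"
  by (induction xs) auto

lemma tail_num_beyond: "length xs < j \<Longrightarrow> tail_num xs j = 0"
  by (induction xs j rule: tail_num.induct) auto

text \<open>The numerators, placed along a leg, pair to 0 with its vertices: \<open>Leg i j\<close>
  carries \<open>- (xs i ! (j - 1))\<close>, position 0 stands for the centre, and past the tip the
  missing neighbour has value 0.\<close>

lemma tail_num_recurrence: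
  assumes "1 \<le> j" "j \<le> length xs"
  shows "tail_num xs (j - 1) + tail_num xs (Suc j) = xs ! (j - 1) * tail_num xs j"
  using assms
proof (induction xs j rule: tail_num.induct)
  case (4 x xs j)
  then show ?case
    by (cases j) auto
qed auto

text \<open>Inductive step: x t0 - t1 >= 2 t0 - t1 > t0 whenever x >= 2 and 0 <= t1 < t0.\<close>

lemma tail_num_decreasing:
  assumes "\<forall>x\<in>set xs. 2 \<le> x"
  shows "0 \<le> tail_num xs 1" "tail_num xs 1 < tail_num xs 0"
proof -
  have "0 \<le> tail_num xs 1 \<and> tail_num xs 1 < tail_num xs 0"
    using assms
  proof (induction xs)
    case (Cons x xs)
    then have IH: "0 \<le> tail_num xs 1" "tail_num xs 1 < tail_num xs 0" and "2 \<le> x"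
      by auto
    then have "2 * tail_num xs 0 \<le> x * tail_num xs 0"
      by (intro mult_right_mono) auto
    with IH show ?case
      unfolding One_nat_def tail_num.simps by linarith
  qed simp
  then show "0 \<le> tail_num xs 1" "tail_num xs 1 < tail_num xs 0"
    by auto
qed

lemma tail_num_pos:
  assumes "\<forall>x\<in>set xs. 2 \<le> x" "j \<le> length xs"
  shows "0 < tail_num xs j"
  using assms
proof (induction xs j rule: tail_num.induct)
  case (3 x xs)
  then show ?case
    using tail_num_decreasing[of "x # xs"] by linarith
qed auto

lemma neg_cont_frac_eq_tail_num:
  assumes "xs \<noteq> []" "\<forall>x\<in>set xs. 2 \<le> x"
  shows "neg_cont_frac xs = of_int (tail_num xs 0) / of_int (tail_num xs 1)"
  using assms
proof (induction xs rule: neg_cont_frac.induct)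
  case (3 x y xs)
  have "0 < tail_num (y # xs) 0"
    using 3 by (intro tail_num_pos) auto
  moreover have IH: "neg_cont_frac (y # xs)
      = of_int (tail_num (y # xs) 0) / of_int (tail_num (y # xs) 1)"
    using 3 by simp
  moreover have "tail_num (x # y # xs) 0 = x * tail_num (y # xs) 0 - tail_num (y # xs) 1"
    "tail_num (x # y # xs) 1 = tail_num (y # xs) 0"
    by simp_all
  ultimately show ?case
    unfolding neg_cont_frac.simps IH by (simp del: tail_num.simps add: diff_divide_distrib)
qed auto

lemma neg_cont_frac_gt_1:
  assumes "xs \<noteq> []" "\<forall>x\<in>set xs. 2 \<le> x"
  shows "1 < neg_cont_frac xs"
proof -
  have "0 < tail_num xs 1"
    using assms by (intro tail_num_pos) (auto simp: Suc_le_eq)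
  then show ?thesis
    using tail_num_decreasing(2)[OF assms(2)] by (simp add: neg_cont_frac_eq_tail_num[OF assms])
qed

text \<open>The tail subtracts a number strictly between 0 and 1, or nothing if it is empty; so the
  first entry is the ceiling of the value. Uniqueness is what evaluates the \<open>THE\<close> in
  \<open>neg_expansion\<close>.\<close>

lemma neg_cont_frac_inject:
  assumes "xs \<noteq> []" "\<forall>x\<in>set xs. 2 \<le> x" "ys \<noteq> []" "\<forall>y\<in>set ys. 2 \<le> y"
    "neg_cont_frac xs = neg_cont_frac ys"
  shows "xs = ys"
  using assms
proof (induction xs arbitrary: ys)
  case (Cons x xs)
  obtain y ys' where ys: "ys = y # ys'"
    using Cons.prems by (cases ys) auto
  have step: "neg_cont_frac (z # zs) = of_int z - (if zs = [] then 0 else 1 / neg_cont_frac zs)"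
    for z zs by (cases zs) auto
  have small: "0 < 1 / neg_cont_frac zs" "1 / neg_cont_frac zs < 1"
    if "zs \<noteq> []" "\<forall>z\<in>set zs. 2 \<le> z" for zs
    using neg_cont_frac_gt_1[OF that] by auto
  have ceil: "\<lceil>neg_cont_frac (z # zs)\<rceil> = z" if "\<forall>u\<in>set (z # zs). 2 \<le> u" for z zs
  proof (cases "zs = []")
    case False
    with that small[of zs] show ?thesis
      unfolding step by (intro ceiling_unique) auto
  qed simp
  have "x = y"
    using ceil[of x xs] ceil[of y ys'] Cons.prems unfolding ys by simp
  moreover have "xs = ys'"
  proof (cases "xs = [] \<or> ys' = []")
    case True
    with Cons.prems(2,4,5) small[of xs] small[of ys'] show ?thesis
      unfolding ys step \<open>x = y\<close> by (auto split: if_splits)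
  next
    case False
    with Cons.prems show ?thesis
      unfolding ys step \<open>x = y\<close> by (intro Cons.IH) auto
  qed
  ultimately show ?case
    by (simp add: ys)
qed simp

lemma neg_expansion_eqI:
  assumes "xs \<noteq> []" "\<forall>x\<in>set xs. 2 \<le> x" "tail_num xs 0 = a" "tail_num xs 1 = b"
  shows "neg_expansion (of_int a / of_int b) = xs"
  unfolding neg_expansion_def
  using assms neg_cont_frac_eq_tail_num[OF assms(1,2)] neg_cont_frac_inject
  by (intro the_equality) auto

text \<open>Applied to the multiplicities of the two Seifert spheres, this says that their \<open>n\<close>-th legs
  differ by one vertex at the end.\<close>

lemma adjacent_fractions_expansions:
  fixes a b a' b' :: int
  assumes "1 \<le> b" "b < a" "a < a'" "a * b' - b * a' = 1"
  shows "\<exists>xs x. xs \<noteq> [] \<and> (\<forall>y\<in>set (xs @ [x]). 2 \<le> y) \<and>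
    tail_num xs 0 = a \<and> tail_num xs 1 = b \<and>
    tail_num (xs @ [x]) 0 = a' \<and> tail_num (xs @ [x]) 1 = b'"
  using assms
proof (induction "nat b" arbitrary: a b a' b' rule: less_induct)
  case less
  \<comment> \<open>\<open>b < b'\<close> is the hypothesis \<open>a < a'\<close> for the pairs (b,
    c) and (b', c') of the recursive call.\<close>
  have "b * a < b * a'"
    using less.prems by simp
  then have "a * b < a * b'"
    using less.prems(4) by (simp add: mult.commute)
  then have bb': "b < b'"
    using less.prems by simp
  show ?case
  proof (cases "b = 1")
    case True
    \<comment> \<open>For b = 1 the relation reads a' = a b' - 1, so a' / b' = [a, b'].\<close>
    then show ?thesis
      using less.prems bb' by (intro exI[of _ "[a]"] exI[of _ b']) auto
  next
    case False
    \<comment> \<open>\<open>x\<close> is the ceiling of a / b: here \<open>b\<close> does not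
      divide \<open>a\<close>, as it would then divide the determinant 1. The same entry is removed
      from both fractions, which preserves the determinant.\<close>
    define x c c' where "x = a div b + 1" and "c = x * b - a" and "c' = x * b' - a'"
    have c: "c = b - a mod b"
      by (simp add: c_def x_def algebra_simps minus_mult_div_eq_mod[symmetric])
    have "b dvd 1" if "a mod b = 0"
    proof -
      have "b dvd a * b' - b * a'"
        using that by (simp add: mod_eq_0_iff_dvd)
      with less.prems(4) show ?thesis by simp
    qed
    then have "a mod b \<noteq> 0"
      using False less.prems(1) by (auto simp: zdvd1_eq)
    moreover have "0 \<le> a mod b" "a mod b < b"
      using less.prems(1) by auto
    ultimately have "1 \<le> c" "c < b"
      using c by auto
    moreover have "b * c' - c * b' = 1"
      using less.prems(4) by (simp add: c_def c'_def algebra_simps)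
    moreover have "nat c < nat b"
      using \<open>1 \<le> c\<close> \<open>c < b\<close> by simp
    ultimately obtain xs y where IH: "xs \<noteq> []" "\<forall>z\<in>set (xs @ [y]). 2 \<le> z"
      "tail_num xs 0 = b" "tail_num xs 1 = c"
      "tail_num (xs @ [y]) 0 = b'" "tail_num (xs @ [y]) 1 = c'"
      using less.hyps[of c b b' c'] bb' by blast
    have "2 \<le> x"
      using less.prems(1,2) pos_imp_zdiv_pos_iff[of b a] by (simp add: x_def)
    with IH show ?thesis
      by (intro exI[of _ "x # xs"] exI[of _ y]) (auto simp: c_def c'_def)
  qed
qed

text \<open>Bezout supplies a larger fraction adjacent to a / b; its expansion without the last
  entry is the one sought, which saves a second Euclidean induction.\<close>

lemma expansion_exists:
  fixes a b :: int
  assumes "1 \<le> b" "b < a" "coprime a b"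
  shows "\<exists>xs. xs \<noteq> [] \<and> (\<forall>x\<in>set xs. 2 \<le> x) \<and> tail_num xs 0 = a \<and> tail_num xs 1 = b"
proof -
  obtain u v where uv: "u * a + v * b = 1"
    using assms(3) bezout_int[of a b] by (auto simp: coprime_iff_gcd_eq_1)
  \<comment> \<open>The pair b' = u + t b, a' = t a - v solves the determinant equation for every t;
    this t is large enough for a' > a.\<close>
  define t where "t = \<bar>v\<bar> + 2"
  have "a * (u + t * b) - b * (t * a - v) = 1"
    using uv by (simp add: algebra_simps)
  moreover have "a < t * a - v"
  proof -
    have "t * a - v - a = (\<bar>v\<bar> * (a - 1)) + (\<bar>v\<bar> - v) + a"
      by (simp add: t_def algebra_simps)
    moreover have "0 \<le> \<bar>v\<bar> * (a - 1)"
      using assms by simp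
    ultimately show ?thesis
      using assms by linarith
  qed
  ultimately show ?thesis
    using adjacent_fractions_expansions[OF assms(1,2)] by fastforce
qed

section \<open>Star-shaped plumbings\<close>

text \<open>Substituting x = \<rho> u and 2 u_s u_t = u_s^2 + u_t^2 - (u_s - u_t)^2 separates a
  potential from an energy on the edges. The double sum meets every edge twice, hence the division
  by 2; diagonal terms of the energy vanish.\<close>

lemma (in plumbing_lattice) form_sum_of_squares:
  fixes \<rho> x :: "'v \<Rightarrow> rat"
  assumes "\<And>v. v \<in> verts \<Gamma> \<Longrightarrow> \<rho> v \<noteq> 0"
  defines "u \<equiv> \<lambda>v. x v / \<rho> v"
  shows "form \<Gamma> x x = (\<Sum>v\<in>verts \<Gamma>. (u v)\<^sup>2 * \<rho> v * vertex_pairing \<Gamma> \<rho> v)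
    - (\<Sum>s\<in>verts \<Gamma>. \<Sum>t\<in>verts \<Gamma>. \<rho> s * \<rho> t * of_int (pairing \<Gamma> s t) * (u s - u t)\<^sup>2) / 2"
proof -
  define q where "q = (\<lambda>s t. \<rho> s * \<rho> t * rat_of_int (pairing \<Gamma> s t))"
  have "x v = \<rho> v * u v" if "v \<in> verts \<Gamma>" for v
    using assms(1)[OF that] by (simp add: u_def)
  then have "form \<Gamma> x x = (\<Sum>s\<in>verts \<Gamma>. \<Sum>t\<in>verts \<Gamma>. q s t * (u s * u t))"
    unfolding form_def by (intro sum.cong refl) (simp add: q_def mult_ac)
  also have "\<dots> = (\<Sum>s\<in>verts \<Gamma>. \<Sum>t\<in>verts \<Gamma>.
      q s t * (u s)\<^sup>2 / 2 + q s t * (u t)\<^sup>2 / 2 - q s t * (u s - u t)\<^sup>2 / 2)"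
    by (intro sum.cong refl) (simp add: field_simps power2_eq_square)
  also have "\<dots> = (\<Sum>s\<in>verts \<Gamma>. \<Sum>t\<in>verts \<Gamma>. q s t * (u s)\<^sup>2) / 2
      + (\<Sum>s\<in>verts \<Gamma>. \<Sum>t\<in>verts \<Gamma>. q s t * (u t)\<^sup>2) / 2
      - (\<Sum>s\<in>verts \<Gamma>. \<Sum>t\<in>verts \<Gamma>. q s t * (u s - u t)\<^sup>2) / 2"
    by (simp only: sum.distrib sum_subtractf sum_divide_distrib)
  also have "(\<Sum>s\<in>verts \<Gamma>. \<Sum>t\<in>verts \<Gamma>. q s t * (u s)\<^sup>2)
      = (\<Sum>s\<in>verts \<Gamma>. \<Sum>t\<in>verts \<Gamma>. q s t * (u t)\<^sup>2)"
    by (subst sum.swap) (intro sum.cong refl, simp add: q_def pairing_sym mult_ac)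
  also have "\<dots> = (\<Sum>v\<in>verts \<Gamma>. (u v)\<^sup>2 * \<rho> v * vertex_pairing \<Gamma> \<rho> v)"
    unfolding vertex_pairing_def
    by (subst sum.swap) (simp add: sum_distrib_left q_def mult_ac)
  finally show ?thesis
    by (simp add: q_def)
qed

text \<open>\<rho> acts as a positive superharmonic function, strict at \<open>c\<close>. Both parts
  of \<open>form_sum_of_squares\<close> are then nonpositive. If the form is not negative at x, both
  vanish, so x / \<rho> is 0 at \<open>c\<close> and constant along edges, hence 0 by
  connectedness.\<close>

lemma (in plumbing_lattice) neg_definiteI:
  assumes pos: "\<And>v. v \<in> verts \<Gamma> \<Longrightarrow> 0 < \<rho> v"
    and nonpos: "\<And>v. v \<in> verts \<Gamma> \<Longrightarrow> vertex_pairing \<Gamma> \<rho> v \<le> 0"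
    and c: "c \<in> verts \<Gamma>" "vertex_pairing \<Gamma> \<rho> c < 0"
    and connected: "\<And>v. v \<in> verts \<Gamma> \<Longrightarrow>
      (c, v) \<in> {(s, t). s \<in> verts \<Gamma> \<and> t \<in> verts \<Gamma> \<and> adj \<Gamma> s t}\<^sup>*"
  shows "neg_definite \<Gamma>"
  unfolding neg_definite_def
proof (intro ballI impI, rule ccontr)
  fix x assume x: "x \<in> rat_lattice_of \<Gamma>" "x \<noteq> (\<lambda>_. 0)" "\<not> form \<Gamma> x x < 0"
  define u where "u = (\<lambda>v. x v / \<rho> v)"
  define f where "f = (\<lambda>v. (u v)\<^sup>2 * \<rho> v * - vertex_pairing \<Gamma> \<rho> v)"
  define g where "g = (\<lambda>s t. \<rho> s * \<rho> t * of_int (pairing \<Gamma> s t) * (u s - u t)\<^sup>2)"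
  have "\<rho> v \<noteq> 0" if "v \<in> verts \<Gamma>" for v
    using pos[OF that] by simp
  from form_sum_of_squares[of \<rho> x, OF this]
  have form: "form \<Gamma> x x = - (\<Sum>v\<in>verts \<Gamma>. f v) - (\<Sum>s\<in>verts \<Gamma>. \<Sum>t\<in>verts \<Gamma>. g s t) / 2"
    by (simp add: f_def g_def u_def sum_negf)
  have f: "0 \<le> f v" if "v \<in> verts \<Gamma>" for v
    using pos[OF that] nonpos[OF that] unfolding f_def by (intro mult_nonneg_nonneg) auto
  have g: "0 \<le> g s t" if "s \<in> verts \<Gamma>" "t \<in> verts \<Gamma>" for s t
  proof (cases "s = t")
    case False
    then show ?thesis
      using pos[OF that(1)] pos[OF that(2)] by (simp add: g_def pairing_def)
  qed (simp add: g_def)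
  have f_sum: "0 \<le> (\<Sum>v\<in>verts \<Gamma>. f v)" and g_sum: "0 \<le> (\<Sum>s\<in>verts \<Gamma>. \<Sum>t\<in>verts \<Gamma>. g s t)"
    by (auto intro!: sum_nonneg f g)
  with x(3) form have "(\<Sum>v\<in>verts \<Gamma>. f v) = 0" "(\<Sum>s\<in>verts \<Gamma>. \<Sum>t\<in>verts \<Gamma>. g s t) = 0"
    by linarith+
  note sums_0 = this
  have f0: "f v = 0" if "v \<in> verts \<Gamma>" for v
    by (rule sum_nonneg_0[OF finite_verts _ sums_0(1) that]) (rule f)
  have rows_0: "(\<Sum>t\<in>verts \<Gamma>. g s t) = 0" if "s \<in> verts \<Gamma>" for s
    by (rule sum_nonneg_0[OF finite_verts _ sums_0(2) that]) (intro sum_nonneg g)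
  have g0: "g s t = 0" if "s \<in> verts \<Gamma>" "t \<in> verts \<Gamma>" for s t
    by (rule sum_nonneg_0[OF finite_verts _ rows_0 that(2)]) (use that g in auto)
  have uc: "u c = 0"
    using f0[OF c(1)] pos[OF c(1)] c(2) by (auto simp: f_def)
  have "u v = 0" if "v \<in> verts \<Gamma>" for v
    using connected[OF that]
  proof (induction rule: rtrancl_induct)
    case (step s t)
    then have st: "s \<in> verts \<Gamma>" "t \<in> verts \<Gamma>" "adj \<Gamma> s t"
      by auto
    show ?case
    proof (cases "s = t")
      case False
      with g0[OF st(1,2)] pos[OF st(1)] pos[OF st(2)] st(3) have "u s = u t"
        by (auto simp: g_def pairing_def)
      with step show ?thesis by simp
    qed (use step in simp)
  qed (rule uc)
  then have "x v = 0" for v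
    using x(1) pos[of v] by (cases "v \<in> verts \<Gamma>") (fastforce simp: u_def rat_lattice_of_def)+
  with x(2) show False
    by blast
qed

text \<open>Position 0 of each leg is the centre, so that \<open>Leg i 1\<close> needs no separate
  treatment among the leg vertices.\<close>

definition leg_value :: "(star_vertex \<Rightarrow> 'a) \<Rightarrow> nat \<Rightarrow> nat \<Rightarrow> 'a" where
  "leg_value x i j = (if j = 0 then x Centre else x (Leg i j))"

section \<open>Pairings in a star graph\<close>

lemma Centre_in_star: "Centre \<in> verts (star_plumbing e\<^sub>0 n xs)"
  by (simp add: star_plumbing_def)

lemma Leg_in_star:
  "Leg i j \<in> verts (star_plumbing e\<^sub>0 n xs) \<longleftrightarrow> i \<in> {1..n} \<and> 1 \<le> j \<and> j \<le> length (xs i)"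
  by (auto simp: star_plumbing_def)

lemma star_adj_commute: "star_adj u v = star_adj v u"
  by (cases u; cases v) auto

lemma finite_star: "finite (verts (star_plumbing e\<^sub>0 n xs))"
proof -
  have "verts (star_plumbing e\<^sub>0 n xs)
      = insert Centre (\<Union>i\<in>{1..n}. Leg i ` {1..length (xs i)})"
    by (auto simp: star_plumbing_def)
  then show ?thesis
    by simp
qed

lemma plumbing_lattice_star: "plumbing_lattice (star_plumbing e\<^sub>0 n xs)"
proof
  show "pairing (star_plumbing e\<^sub>0 n xs) u v = pairing (star_plumbing e\<^sub>0 n xs) v u" for u v
    by (simp add: pairing_def star_plumbing_def star_adj_commute)
qed (rule finite_star)

text \<open>A vector of the lattice vanishes off the graph, so the outer neighbour
  \<open>Leg i (Suc j)\<close> may be counted even when \<open>j\<close> is the tip, and one formula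
  covers the whole leg.\<close>

lemma vertex_pairing_Leg:
  assumes x: "x \<in> rat_lattice_of (star_plumbing e\<^sub>0 n xs)"
    and j: "i \<in> {1..n}" "1 \<le> j" "j \<le> length (xs i)"
  shows "vertex_pairing (star_plumbing e\<^sub>0 n xs) x (Leg i j)
    = leg_value x i (j - 1) + leg_value x i (Suc j) - of_int (xs i ! (j - 1)) * x (Leg i j)"
proof -
  let ?\<Gamma> = "star_plumbing e\<^sub>0 n xs"
  define p where "p = (if j = 1 then Centre else Leg i (j - 1))"
  let ?T = "{p, Leg i (Suc j), Leg i j}"
  let ?f = "\<lambda>u. x u * rat_of_int (pairing ?\<Gamma> u (Leg i j))"
  have distinct: "p \<noteq> Leg i (Suc j)" "p \<noteq> Leg i j" "Leg i (Suc j) \<noteq> Leg i j"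
    using j(2) by (auto simp: p_def)
  have zero: "?f u = 0" if u: "u \<notin> ?T" for u
  proof (cases "u \<in> verts ?\<Gamma>")
    case True
    with u j(2) show ?thesis
      by (cases u) (auto simp: pairing_def star_plumbing_def p_def split: if_splits)
  qed (use x in \<open>simp add: rat_lattice_of_def\<close>)
  have "sum ?f (verts ?\<Gamma>) = sum ?f ?T"
  proof (rule sum.same_carrierI[of "verts ?\<Gamma> \<union> ?T"])
    show "?f u = 0" if "u \<in> verts ?\<Gamma> \<union> ?T - verts ?\<Gamma>" for u
      using x that by (simp add: rat_lattice_of_def)
    show "?f u = 0" if "u \<in> verts ?\<Gamma> \<union> ?T - ?T" for u
      using that by (intro zero) blast
  qed (auto simp: finite_star)
  also have "\<dots> = ?f p + ?f (Leg i (Suc j)) + ?f (Leg i j)"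
    using distinct by simp
  also have "pairing ?\<Gamma> p (Leg i j) = 1"
    using j(2) by (auto simp: pairing_def star_plumbing_def p_def)
  also have "pairing ?\<Gamma> (Leg i (Suc j)) (Leg i j) = 1"
    by (simp add: pairing_def star_plumbing_def)
  also have "pairing ?\<Gamma> (Leg i j) (Leg i j) = - (xs i ! (j - 1))"
    by (simp add: pairing_def star_plumbing_def)
  also have "x p = leg_value x i (j - 1)"
    using j(2) by (auto simp: p_def leg_value_def)
  finally show ?thesis
    by (simp add: vertex_pairing_def leg_value_def)
qed

lemma vertex_pairing_Centre:
  assumes x: "x \<in> rat_lattice_of (star_plumbing e\<^sub>0 n xs)"
  shows "vertex_pairing (star_plumbing e\<^sub>0 n xs) x Centre
    = of_int e\<^sub>0 * x Centre + (\<Sum>i=1..n. x (Leg i 1))"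
proof -
  let ?\<Gamma> = "star_plumbing e\<^sub>0 n xs"
  let ?L = "(\<lambda>i. Leg i 1) ` {1..n}"
  let ?f = "\<lambda>u. x u * rat_of_int (pairing ?\<Gamma> u Centre)"
  have zero: "?f u = 0" if u: "u \<notin> insert Centre ?L" for u
  proof (cases "u \<in> verts ?\<Gamma>")
    case True
    with u obtain i j where "u = Leg i j" "i \<in> {1..n}"
      by (cases u) (auto simp: Leg_in_star)
    moreover from this u have "j \<noteq> 1"
      by blast
    ultimately show ?thesis
      by (simp add: pairing_def star_plumbing_def)
  qed (use x in \<open>simp add: rat_lattice_of_def\<close>)
  have "sum ?f (verts ?\<Gamma>) = sum ?f (insert Centre ?L)"
  proof (rule sum.same_carrierI[of "verts ?\<Gamma> \<union> insert Centre ?L"])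
    show "?f u = 0" if "u \<in> verts ?\<Gamma> \<union> insert Centre ?L - verts ?\<Gamma>" for u
      using x that by (simp add: rat_lattice_of_def)
    show "?f u = 0" if "u \<in> verts ?\<Gamma> \<union> insert Centre ?L - insert Centre ?L" for u
      using that by (intro zero) blast
  qed (auto simp: finite_star)
  also have "\<dots> = ?f Centre + sum ?f ?L"
    by (rule sum.insert) auto
  also have "sum ?f ?L = (\<Sum>i=1..n. x (Leg i 1))"
    by (subst sum.reindex) (auto simp: inj_on_def pairing_def star_plumbing_def)
  also have "?f Centre = of_int e\<^sub>0 * x Centre"
    by (simp add: pairing_def star_plumbing_def)
  finally show ?thesis
    by (simp add: vertex_pairing_def)
qed

lemma star_connected:
  fixes e\<^sub>0 n xs
  defines "\<Gamma> \<equiv> star_plumbing e\<^sub>0 n xs"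
  assumes "v \<in> verts \<Gamma>"
  shows "(Centre, v) \<in> {(s, t). s \<in> verts \<Gamma> \<and> t \<in> verts \<Gamma> \<and> adj \<Gamma> s t}\<^sup>*"
proof (cases v)
  case (Leg i j)
  have adj: "adj \<Gamma> = star_adj"
    by (simp add: \<Gamma>_def star_plumbing_def)
  from assms(2) have "(Centre, Leg i j) \<in> {(s, t). s \<in> verts \<Gamma> \<and> t \<in> verts \<Gamma> \<and> adj \<Gamma> s t}\<^sup>*"
    unfolding Leg
  proof (induction j)
    case 0
    then show ?case
      by (simp add: \<Gamma>_def Leg_in_star)
  next
    case (Suc j)
    show ?case
    proof (cases j)
      case 0
      then show ?thesis
        using Suc.prems by (intro r_into_rtrancl) (auto simp: adj, simp add: \<Gamma>_def Centre_in_star)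
    next
      case (Suc k)
      then have "Leg i j \<in> verts \<Gamma>"
        using Suc.prems by (simp add: \<Gamma>_def Leg_in_star)
      with Suc.prems show ?thesis
        by (intro rtrancl_into_rtrancl[OF Suc.IH]) (auto simp: adj)
    qed
  qed
  then show ?thesis
    by (simp add: Leg)
qed simp

definition star_vector ::
    "nat \<Rightarrow> (nat \<Rightarrow> int list) \<Rightarrow> int \<Rightarrow> (nat \<Rightarrow> nat \<Rightarrow> int) \<Rightarrow> star_vertex \<Rightarrow> int" where
  "star_vector n xs c f = (\<lambda>v. case v of Centre \<Rightarrow> c
     | Leg i j \<Rightarrow> if i \<in> {1..n} \<and> 1 \<le> j \<and> j \<le> length (xs i) then f i j else 0)"

lemma star_vector_lattice: "star_vector n xs c f \<in> lattice_of (star_plumbing e\<^sub>0 n xs)"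
  by (auto simp: lattice_of_def star_vector_def star_plumbing_def split: star_vertex.split)

lemma star_vector_rat_lattice:
  "to_rat (star_vector n xs c f) \<in> rat_lattice_of (star_plumbing e\<^sub>0 n xs)"
  using star_vector_lattice[of n xs c f e\<^sub>0] by (simp add: lattice_of_def rat_lattice_of_def)

text \<open>The conditions on \<open>f i\<close> at 0 and at \<open>Suc (length (xs i))\<close> are
  boundary conditions: they let \<open>f\<close> stand in for the truncated vector at the centre and
  past the tip.\<close>

lemma vertex_pairing_star_vector_Leg:
  assumes "i \<in> {1..n}" "1 \<le> j" "j \<le> length (xs i)" "f i 0 = c" "f i (Suc (length (xs i))) = 0"
  shows "vertex_pairing (star_plumbing e\<^sub>0 n xs) (to_rat (star_vector n xs c f)) (Leg i j)
    = of_int (f i (j - 1) + f i (Suc j) - xs i ! (j - 1) * f i j)"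
proof -
  have "leg_value (to_rat (star_vector n xs c f)) i l = of_int (f i l)"
    if "l \<le> Suc (length (xs i))" for l
    using that assms by (auto simp: leg_value_def star_vector_def le_Suc_eq)
  then show ?thesis
    using assms(1-3) by (subst vertex_pairing_Leg[OF star_vector_rat_lattice])
      (auto simp: star_vector_def)
qed

lemma vertex_pairing_star_vector_Centre:
  assumes "\<And>i. i \<in> {1..n} \<Longrightarrow> xs i \<noteq> []"
  shows "vertex_pairing (star_plumbing e\<^sub>0 n xs) (to_rat (star_vector n xs c f)) Centre
    = of_int (e\<^sub>0 * c + (\<Sum>i=1..n. f i 1))"
proof -
  have "(\<Sum>i=1..n. to_rat (star_vector n xs c f) (Leg i 1)) = (\<Sum>i=1..n. of_int (f i 1))"
    using assms by (intro sum.cong refl) (auto simp: star_vector_def Suc_le_eq)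
  then show ?thesis
    by (subst vertex_pairing_Centre[OF star_vector_rat_lattice]) (simp add: star_vector_def)
qed

section \<open>Seifert data\<close>

definition cofactor :: "nat \<Rightarrow> (nat \<Rightarrow> int) \<Rightarrow> nat \<Rightarrow> int" where
  "cofactor n a i = (\<Prod>j\<in>{1..n} - {i}. a j)"

lemma cofactor_mult: "i \<in> {1..n} \<Longrightarrow> cofactor n a i * a i = (\<Prod>j=1..n. a j)"
  unfolding cofactor_def by (subst prod.remove[of "{1..n}" i]) (auto simp: mult.commute)

lemma dvd_cofactor: "l \<in> {1..n} \<Longrightarrow> l \<noteq> i \<Longrightarrow> a l dvd cofactor n a i"
  unfolding cofactor_def by (rule dvd_prodI) auto

lemma coprime_cofactor:
  assumes "pairwise (\<lambda>i j. coprime (a i) (a j)) {1..n}" "i \<in> {1..n}"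
  shows "coprime (cofactor n a i) (a i)"
  unfolding cofactor_def
  by (rule prod_coprime_left) (use assms in \<open>auto simp: pairwise_def\<close>)

lemma seifert_equation_iff:
  assumes "\<And>i. i \<in> {1..n} \<Longrightarrow> a i \<ge> (2::int)"
  shows "(\<Sum>i=1..n. rat_of_int (b i) / rat_of_int (a i)) * of_int (\<Prod>j=1..n. a j)
       = - 1 - of_int e\<^sub>0 * of_int (\<Prod>j=1..n. a j)
    \<longleftrightarrow> e\<^sub>0 * (\<Prod>j=1..n. a j) + (\<Sum>i=1..n. cofactor n a i * b i) = - 1"
proof -
  have "rat_of_int (b i) / rat_of_int (a i) * of_int (\<Prod>j=1..n. a j) = of_int (cofactor n a i * b i)"
    if "i \<in> {1..n}" for i
    using assms[OF that] unfolding cofactor_mult[OF that, symmetric] by simp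
  then have "(\<Sum>i=1..n. rat_of_int (b i) / rat_of_int (a i)) * of_int (\<Prod>j=1..n. a j)
      = of_int (\<Sum>i=1..n. cofactor n a i * b i)"
    unfolding sum_distrib_right of_int_sum by (intro sum.cong) auto
  moreover have "- 1 - rat_of_int e\<^sub>0 * of_int (\<Prod>j=1..n. a j)
      = of_int (- 1 - e\<^sub>0 * (\<Prod>j=1..n. a j))"
    by simp
  ultimately show ?thesis
    by (simp only: of_int_eq_iff) linarith
qed

lemma prod_dvd_of_pairwise_coprime:
  fixes a :: "'i \<Rightarrow> int"
  assumes "finite I" "pairwise (\<lambda>i j. coprime (a i) (a j)) I" "\<And>i. i \<in> I \<Longrightarrow> a i dvd m"
  shows "(\<Prod>i\<in>I. a i) dvd m"
  using assms
proof (induction I rule: finite_induct)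
  case (insert i I)
  have "coprime (a i) (\<Prod>j\<in>I. a j)"
    using insert.prems(1) insert.hyps by (intro prod_coprime_right) (auto simp: pairwise_insert)
  with insert show ?case
    by (auto simp: pairwise_insert intro: divides_mult)
qed simp

text \<open>Modulo \<open>a i\<close> only the i-th term of the Seifert equation survives. This
  fixes \<open>b i\<close> modulo \<open>a i\<close>, makes the two coprime, and for i = n supplies
  the quotient from which b' is built.\<close>

lemma seifert_residue:
  assumes "\<And>i. i \<in> {1..n} \<Longrightarrow> a i \<ge> 2" "is_seifert_data n a e\<^sub>0 b" "i \<in> {1..n}"
  shows "a i dvd cofactor n a i * b i + 1"
proof -
  have eq: "e\<^sub>0 * (\<Prod>j=1..n. a j) + (\<Sum>l=1..n. cofactor n a l * b l) = - 1"
    using assms seifert_equation_iff[of n a b e\<^sub>0] by (auto simp: is_seifert_data_def)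
  have "cofactor n a i * b i + 1
      = - (e\<^sub>0 * (cofactor n a i * a i)) - (\<Sum>l\<in>{1..n} - {i}. cofactor n a l * b l)"
    using eq unfolding cofactor_mult[OF assms(3)] sum.remove[OF finite_atLeastAtMost assms(3)]
    by linarith
  moreover have "a i dvd (\<Sum>l\<in>{1..n} - {i}. cofactor n a l * b l)"
    using assms(3) by (intro dvd_sum dvd_mult2 dvd_cofactor) auto
  ultimately show ?thesis
    by simp
qed

text \<open>Chinese remaindering: \<open>\<beta> i\<close> is minus the inverse of the cofactor
  modulo \<open>a i\<close>; then the sum plus 1 is divisible by every \<open>a i\<close>, hence by
  their product, and the quotient is minus \<open>e\<^sub>0\<close>.\<close>

lemma seifert_data_exists:
  assumes "\<And>i. i \<in> {1..n} \<Longrightarrow> a i \<ge> 2" "pairwise (\<lambda>i j. coprime (a i) (a j)) {1..n}"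
  shows "\<exists>e\<^sub>0 b. is_seifert_data n a e\<^sub>0 b"
proof -
  have "\<exists>\<beta>\<in>{1..<a i}. a i dvd cofactor n a i * \<beta> + 1" if i: "i \<in> {1..n}" for i
  proof -
    obtain u v where uv: "u * cofactor n a i + v * a i = 1"
      using coprime_cofactor[OF assms(2) i] bezout_int[of "cofactor n a i" "a i"]
      by (auto simp: coprime_iff_gcd_eq_1)
    define \<beta> where "\<beta> = (- u) mod a i"
    have "cofactor n a i * \<beta> + 1 = a i * (v - cofactor n a i * ((- u) div a i))"
      using uv by (simp add: \<beta>_def algebra_simps minus_mult_div_eq_mod[symmetric])
    then have dvd: "a i dvd cofactor n a i * \<beta> + 1"
      by simp
    have "\<beta> \<noteq> 0"
      using dvd assms(1)[OF i] by (auto simp: zdvd1_eq)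
    moreover have "0 \<le> \<beta>" "\<beta> < a i"
      using assms(1)[OF i] by (auto simp: \<beta>_def)
    ultimately show ?thesis
      using dvd by (intro bexI[of _ \<beta>]) auto
  qed
  then obtain \<beta> where \<beta>: "\<And>i. i \<in> {1..n} \<Longrightarrow> \<beta> i \<in> {1..<a i}"
    "\<And>i. i \<in> {1..n} \<Longrightarrow> a i dvd cofactor n a i * \<beta> i + 1"
    by metis
  \<comment> \<open>Restriction makes \<open>b\<close> extensional, as the dependent product in
    \<open>is_seifert_data\<close> demands.\<close>
  define b where "b = restrict \<beta> {1..n}"
  have b: "b i = \<beta> i" if "i \<in> {1..n}" for i
    using that by (simp add: b_def)
  have "(\<Prod>i=1..n. a i) dvd (\<Sum>l=1..n. cofactor n a l * b l) + 1"
  proof (rule prod_dvd_of_pairwise_coprime[OF _ assms(2)])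
    fix i assume i: "i \<in> {1..n}"
    have "a i dvd (\<Sum>l\<in>{1..n} - {i}. cofactor n a l * b l)"
      using i by (intro dvd_sum dvd_mult2 dvd_cofactor) auto
    moreover have "(\<Sum>l=1..n. cofactor n a l * b l) + 1
        = (cofactor n a i * b i + 1) + (\<Sum>l\<in>{1..n} - {i}. cofactor n a l * b l)"
      using i by (subst sum.remove[of "{1..n}" i]) auto
    ultimately show "a i dvd (\<Sum>l=1..n. cofactor n a l * b l) + 1"
      using \<beta>(2)[OF i] b[OF i] by (metis dvd_add)
  qed simp
  then obtain e where "(\<Sum>l=1..n. cofactor n a l * b l) + 1 = (\<Prod>i=1..n. a i) * e"
    by blast
  then have "- e * (\<Prod>j=1..n. a j) + (\<Sum>l=1..n. cofactor n a l * b l) = - 1"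
    by (simp add: mult.commute)
  then have "is_seifert_data n a (- e) b"
    unfolding is_seifert_data_def
    using \<beta>(1) by (intro conjI iffD2[OF seifert_equation_iff] assms(1)) (auto simp: b_def)
  then show ?thesis
    by blast
qed

lemma seifert_data_unique:
  assumes a: "\<And>i. i \<in> {1..n} \<Longrightarrow> a i \<ge> 2" "pairwise (\<lambda>i j. coprime (a i) (a j)) {1..n}"
    and "is_seifert_data n a e\<^sub>0 b" "is_seifert_data n a e\<^sub>1 c"
  shows "e\<^sub>0 = e\<^sub>1 \<and> b = c"
proof
  have bc: "b \<in> (\<Pi>\<^sub>E i\<in>{1..n}. {1..<a i})" "c \<in> (\<Pi>\<^sub>E i\<in>{1..n}. {1..<a i})"
    using assms by (auto simp: is_seifert_data_def)
  show "b = c"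
  proof (rule PiE_ext[OF bc])
    fix i assume i: "i \<in> {1..n}"
    have "a i dvd (cofactor n a i * b i + 1) - (cofactor n a i * c i + 1)"
      by (intro dvd_diff seifert_residue[OF a(1) assms(3) i] seifert_residue[OF a(1) assms(4) i])
    then have "a i dvd cofactor n a i * (b i - c i)"
      by (simp add: algebra_simps)
    then have "a i dvd b i - c i"
      using coprime_cofactor[OF a(2) i]
      by (simp add: coprime_commute coprime_dvd_mult_right_iff)
    moreover have "\<bar>b i - c i\<bar> < a i"
      using PiE_mem[OF bc(1) i] PiE_mem[OF bc(2) i] by auto
    ultimately show "b i = c i"
      using dvd_imp_le_int[of "b i - c i" "a i"] by force
  qed
  have "e\<^sub>0 * (\<Prod>j=1..n. a j) + (\<Sum>l=1..n. cofactor n a l * b l) = - 1"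
    "e\<^sub>1 * (\<Prod>j=1..n. a j) + (\<Sum>l=1..n. cofactor n a l * c l) = - 1"
    using assms(3,4) seifert_equation_iff[OF a(1)] by (auto simp: is_seifert_data_def)
  then have "e\<^sub>0 * (\<Prod>j=1..n. a j) = e\<^sub>1 * (\<Prod>j=1..n. a j)"
    unfolding \<open>b = c\<close> by linarith
  moreover have "(\<Prod>j=1..n. a j) \<noteq> 0"
    using a(1) by (force simp: prod_zero_iff)
  ultimately show "e\<^sub>0 = e\<^sub>1"
    by simp
qed

lemma seifert_data_eqI:
  assumes "\<And>i. i \<in> {1..n} \<Longrightarrow> a i \<ge> 2" "pairwise (\<lambda>i j. coprime (a i) (a j)) {1..n}"
    and "is_seifert_data n a e\<^sub>0 b"
  shows "seifert_data n a = (e\<^sub>0, b)"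
  unfolding seifert_data_def
  by (rule the_equality) (use assms seifert_data_unique[OF assms(1,2)] in \<open>auto simp: prod_eq_iff\<close>)

lemma coprime_mult_Ints:
  fixes z :: rat
  assumes "coprime p q" "of_int p * z \<in> \<int>" "of_int q * z \<in> \<int>"
  shows "z \<in> \<int>"
proof -
  obtain u v where "u * p + v * q = 1"
    using assms(1) bezout_int[of p q] by (auto simp: coprime_iff_gcd_eq_1)
  then have "rat_of_int (u * p + v * q) = 1"
    by simp
  then have "z = (of_int u * of_int p + of_int v * of_int q) * z"
    by simp
  also have "\<dots> = of_int u * (of_int p * z) + of_int v * (of_int q * z)"
    by (simp add: algebra_simps)
  also have "\<dots> \<in> \<int>"
    using assms(2,3) by (metis Ints_add Ints_mult Ints_of_int)
  finally show ?thesis .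
qed

section \<open>Definiteness and unimodularity of the Seifert star\<close>

locale seifert_star =
  fixes n :: nat and a :: "nat \<Rightarrow> int" and e\<^sub>0 :: int and b :: "nat \<Rightarrow> int"
    and xs :: "nat \<Rightarrow> int list"
  assumes a_ge_2: "i \<in> {1..n} \<Longrightarrow> a i \<ge> 2"
    and a_coprime: "pairwise (\<lambda>i j. coprime (a i) (a j)) {1..n}"
    and seifert: "e\<^sub>0 * (\<Prod>j=1..n. a j) + (\<Sum>i=1..n. cofactor n a i * b i) = - 1"
    and xs_ge_2: "i \<in> {1..n} \<Longrightarrow> \<forall>x\<in>set (xs i). 2 \<le> x"
    and tail_num_0: "i \<in> {1..n} \<Longrightarrow> tail_num (xs i) 0 = a i"
    and tail_num_1: "i \<in> {1..n} \<Longrightarrow> tail_num (xs i) 1 = b i"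
begin

abbreviation "\<Gamma> \<equiv> star_plumbing e\<^sub>0 n xs"

sublocale plumbing_lattice \<Gamma>
  by (rule plumbing_lattice_star)

lemma xs_nonempty: "i \<in> {1..n} \<Longrightarrow> xs i \<noteq> []"
  using a_ge_2[of i] tail_num_0[of i] by auto

text \<open>Up to sign, the dual basis vector of the centre.\<close>

definition central :: "star_vertex \<Rightarrow> int" where
  "central = star_vector n xs (\<Prod>j=1..n. a j) (\<lambda>i j. cofactor n a i * tail_num (xs i) j)"

lemma central_pos: "v \<in> verts \<Gamma> \<Longrightarrow> 0 < central v"
proof (cases v)
  case Centre
  then show ?thesis
    using a_ge_2 by (force simp: central_def star_vector_def intro!: prod_pos)
next
  case (Leg i j)
  assume "v \<in> verts \<Gamma>"
  then have i: "i \<in> {1..n}" and j: "1 \<le> j" "j \<le> length (xs i)"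
    by (auto simp: Leg Leg_in_star)
  have "0 < cofactor n a i"
    unfolding cofactor_def using a_ge_2 by (force intro!: prod_pos)
  with i j show ?thesis
    using tail_num_pos[OF xs_ge_2[OF i] j(2)] by (simp add: Leg central_def star_vector_def)
qed

text \<open>On the legs this is \<open>tail_num_recurrence\<close>, with the cofactors scaling all
  legs to a common value at the centre. At the centre it is the Seifert equation, whose right side
  -1 later yields the central coefficient without division.\<close>

lemma vertex_pairing_central:
  assumes "v \<in> verts \<Gamma>"
  shows "vertex_pairing \<Gamma> (to_rat central) v = (if v = Centre then - 1 else 0)"
proof (cases v)
  case Centre
  have "(\<Sum>i=1..n. cofactor n a i * tail_num (xs i) 1) = (\<Sum>i=1..n. cofactor n a i * b i)"
    using tail_num_1 by (intro sum.cong refl) simp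
  then show ?thesis
    unfolding Centre central_def
    by (subst vertex_pairing_star_vector_Centre) (use xs_nonempty seifert in simp_all)
next
  case (Leg i j)
  with assms have i: "i \<in> {1..n}" and j: "1 \<le> j" "j \<le> length (xs i)"
    by (auto simp: Leg_in_star)
  have "cofactor n a i * tail_num (xs i) (j - 1) + cofactor n a i * tail_num (xs i) (Suc j)
      - xs i ! (j - 1) * (cofactor n a i * tail_num (xs i) j) = 0"
    using tail_num_recurrence[OF j] by algebra
  then show ?thesis
    unfolding Leg central_def using i j
    by (subst vertex_pairing_star_vector_Leg)
      (simp_all add: tail_num_0 cofactor_mult tail_num_beyond)
qed

lemma neg_definite_star: "neg_definite \<Gamma>"
proof (rule neg_definiteI[of "to_rat central" Centre])
  show "0 < to_rat central v" if "v \<in> verts \<Gamma>" for v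
    using central_pos[OF that] by simp
  show "(Centre, v) \<in> {(s, t). s \<in> verts \<Gamma> \<and> t \<in> verts \<Gamma> \<and> adj \<Gamma> s t}\<^sup>*"
    if "v \<in> verts \<Gamma>" for v
    using that by (rule star_connected)
qed (simp_all add: vertex_pairing_central Centre_in_star)

text \<open>A test vector with the numerators of one leg but 0 instead of \<open>a i\<close> at the
  centre; the missing value causes the defect \<open>- a i\<close> at \<open>Leg i 1\<close>. Once
  the central coefficient of a vector is known, it detects \<open>a i\<close> times the first
  coefficient on the leg.\<close>

lemma vertex_pairing_leg_vector:
  assumes "i \<in> {1..n}" "v \<in> verts \<Gamma>"
  defines "s \<equiv> star_vector n xs 0 (\<lambda>l j. if l = i \<and> j \<noteq> 0 then tail_num (xs i) j else 0)"
  shows "vertex_pairing \<Gamma> (to_rat s) v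
    = (if v = Centre then of_int (b i) else if v = Leg i 1 then - of_int (a i) else 0)"
proof (cases v)
  case Centre
  have "(\<Sum>l=1..n. if l = i then tail_num (xs i) 1 else 0) = b i"
    using assms(1) by (simp add: tail_num_1[unfolded One_nat_def])
  then show ?thesis
    unfolding Centre s_def
    by (subst vertex_pairing_star_vector_Centre) (use xs_nonempty in auto)
next
  case (Leg l j)
  with assms have l: "l \<in> {1..n}" and j: "1 \<le> j" "j \<le> length (xs l)"
    by (auto simp: Leg_in_star)
  show ?thesis
  proof (cases "l = i")
    case True
    have "tail_num (xs i) (j - 1) + tail_num (xs i) (Suc j) - xs i ! (j - 1) * tail_num (xs i) j = 0"
      using tail_num_recurrence[of j "xs i"] j True by simp
    moreover have "tail_num (xs i) (j - 1) = a i" if "j = 1"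
      using that tail_num_0[OF assms(1)] by simp
    ultimately have *: "(if j - 1 \<noteq> 0 then tail_num (xs i) (j - 1) else 0) + tail_num (xs i) (Suc j)
        - xs i ! (j - 1) * tail_num (xs i) j = (if j = 1 then - a i else 0)"
      using j(1) by auto
    show ?thesis
      unfolding Leg s_def using l j *
      by (subst vertex_pairing_star_vector_Leg) (auto simp: True tail_num_beyond)
  next
    case False
    then show ?thesis
      unfolding Leg s_def using l j by (subst vertex_pairing_star_vector_Leg) auto
  qed
qed

text \<open>\<open>central\<close> handles the central coefficient, and the leg vectors show that
  \<open>a i\<close> times the first coefficient of leg i is integral. By the pairing with the
  centre, the first coefficients have an integral sum; multiplied by the i-th cofactor, all its
  terms but the i-th are known to be integral, and coprimality with \<open>a i\<close>
  finishes.\<close>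

lemma unimodular_star: "unimodular \<Gamma>"
  unfolding unimodular_def
proof (intro ballI impI)
  fix z assume z: "z \<in> rat_lattice_of \<Gamma>" and int: "\<forall>v\<in>verts \<Gamma>. vertex_pairing \<Gamma> z v \<in> \<int>"
  have form_int: "form \<Gamma> z (to_rat y) \<in> \<int>" for y
    unfolding form_eq_sum_right using int by (intro Ints_sum Ints_mult) auto
  have "form \<Gamma> z (to_rat central) = - z Centre"
    using finite_verts Centre_in_star[of e\<^sub>0 n xs]
    by (simp add: form_eq_sum_left vertex_pairing_central if_distrib cong: if_cong)
  with form_int[of central] have centre: "z Centre \<in> \<int>"
    by simp
  have multiple: "of_int (a i) * z (Leg i 1) \<in> \<int>" if i: "i \<in> {1..n}" for i
  proof -
    define s where "s = star_vector n xs 0 (\<lambda>l j. if l = i \<and> j \<noteq> 0 then tail_num (xs i) j else 0)"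
    have "Leg i 1 \<in> verts \<Gamma>"
      using i xs_nonempty[OF i] by (auto simp: Leg_in_star Suc_le_eq)
    moreover have "form \<Gamma> z (to_rat s) = (\<Sum>v\<in>verts \<Gamma>. (if v = Centre then z Centre * of_int (b i) else 0)
        + (if v = Leg i 1 then - of_int (a i) * z (Leg i 1) else 0))"
      unfolding form_eq_sum_left
    proof (intro sum.cong refl)
      fix v assume v: "v \<in> verts \<Gamma>"
      show "z v * vertex_pairing \<Gamma> (to_rat s) v = (if v = Centre then z Centre * of_int (b i) else 0)
          + (if v = Leg i 1 then - of_int (a i) * z (Leg i 1) else 0)"
        unfolding vertex_pairing_leg_vector[OF i v, folded s_def] by simp
    qed
    ultimately have "form \<Gamma> z (to_rat s) = z Centre * of_int (b i) - of_int (a i) * z (Leg i 1)"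
      using finite_verts Centre_in_star[of e\<^sub>0 n xs] by (simp add: sum.distrib)
    then have "of_int (a i) * z (Leg i 1) = z Centre * of_int (b i) - form \<Gamma> z (to_rat s)"
      by simp
    also have "\<dots> \<in> \<int>"
      using form_int centre by (intro Ints_diff Ints_mult) auto
    finally show ?thesis .
  qed
  have total: "(\<Sum>i=1..n. z (Leg i 1)) \<in> \<int>"
  proof -
    have "vertex_pairing \<Gamma> z Centre - of_int e\<^sub>0 * z Centre \<in> \<int>"
      using int centre Centre_in_star by (intro Ints_diff Ints_mult) auto
    then show ?thesis
      by (simp add: vertex_pairing_Centre[OF z])
  qed
  have first: "z (Leg i 1) \<in> \<int>" if i: "i \<in> {1..n}" for i
  proof (rule coprime_mult_Ints[OF coprime_cofactor[OF a_coprime i] _ multiple[OF i]])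
    have "of_int (cofactor n a i) * z (Leg l 1) \<in> \<int>" if l: "l \<in> {1..n} - {i}" for l
    proof -
      obtain d where "cofactor n a i = a l * d"
        using dvd_cofactor[of l n i a] l by auto
      then have "of_int (cofactor n a i) * z (Leg l 1) = of_int d * (of_int (a l) * z (Leg l 1))"
        by simp
      also have "\<dots> \<in> \<int>"
        using l by (intro Ints_mult multiple) auto
      finally show ?thesis .
    qed
    then have "of_int (cofactor n a i) * (\<Sum>l=1..n. z (Leg l 1))
        - (\<Sum>l\<in>{1..n} - {i}. of_int (cofactor n a i) * z (Leg l 1)) \<in> \<int>"
      by (intro Ints_diff[OF Ints_mult[OF Ints_of_int total] Ints_sum])
    also have "of_int (cofactor n a i) * (\<Sum>l=1..n. z (Leg l 1))
        - (\<Sum>l\<in>{1..n} - {i}. of_int (cofactor n a i) * z (Leg l 1))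
        = of_int (cofactor n a i) * z (Leg i 1)"
      unfolding sum.remove[OF finite_atLeastAtMost i] by (simp add: sum_distrib_left distrib_left)
    finally show "of_int (cofactor n a i) * z (Leg i 1) \<in> \<int>" .
  qed
  \<comment> \<open>The pairing with a leg vertex contains the outer neighbour with coefficient 1,
    so integrality spreads outwards from the centre.\<close>
  have legs: "leg_value z i j \<in> \<int> \<and> leg_value z i (Suc j) \<in> \<int>" if i: "i \<in> {1..n}" for i j
  proof (induction j)
    case 0
    then show ?case
      using centre first[OF i] by (simp add: leg_value_def)
  next
    case (Suc j)
    show ?case
    proof (cases "Suc j \<le> length (xs i)")
      case True
      then have "leg_value z i (Suc (Suc j)) = vertex_pairing \<Gamma> z (Leg i (Suc j)) - leg_value z i j
          + of_int (xs i ! j) * leg_value z i (Suc j)"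
        by (subst vertex_pairing_Leg[OF z i]) (auto simp: leg_value_def)
      also have "\<dots> \<in> \<int>"
        using Suc int i True by (intro Ints_add Ints_diff Ints_mult) (auto simp: Leg_in_star)
      finally show ?thesis
        using Suc by simp
    next
      case False
      then have "leg_value z i (Suc (Suc j)) = 0"
        using z by (simp add: leg_value_def rat_lattice_of_def Leg_in_star)
      with Suc show ?thesis
        by simp
    qed
  qed
  show "\<forall>v. z v \<in> \<int>"
  proof
    fix v show "z v \<in> \<int>"
    proof (cases "v \<in> verts \<Gamma>")
      case True
      show ?thesis
      proof (cases v)
        case (Leg i j)
        with True have "i \<in> {1..n}" "j \<noteq> 0"
          by (auto simp: Leg_in_star)
        with legs[of i j] show ?thesis
          by (simp add: Leg leg_value_def)
      qed (simp add: centre)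
    qed (use z in \<open>simp add: rat_lattice_of_def\<close>)
  qed
qed

end

text \<open>Plumbings are compared as records and \<open>decor\<close> is a total function; hence
  the last assumption, which pins \<open>xs\<close> down at indices that name no leg.\<close>

lemma seifert_plumbing_eq:
  assumes a: "\<And>i. i \<in> {1..n} \<Longrightarrow> a i \<ge> 2" "pairwise (\<lambda>i j. coprime (a i) (a j)) {1..n}"
    and data: "is_seifert_data n a e\<^sub>0 b"
    and xs: "\<And>i. i \<in> {1..n} \<Longrightarrow> \<forall>x\<in>set (xs i). 2 \<le> x"
      "\<And>i. i \<in> {1..n} \<Longrightarrow> tail_num (xs i) 0 = a i"
      "\<And>i. i \<in> {1..n} \<Longrightarrow> tail_num (xs i) 1 = b i"
      "\<And>i. i \<notin> {1..n} \<Longrightarrow> xs i = neg_expansion (of_int (a i) / of_int (b i))"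
  shows "seifert_plumbing n a = star_plumbing e\<^sub>0 n xs"
proof -
  have "neg_expansion (of_int (a i) / of_int (b i)) = xs i" for i
  proof (cases "i \<in> {1..n}")
    case True
    then have "xs i \<noteq> []"
      using a(1)[OF True] xs(2)[OF True] by auto
    with True xs show ?thesis
      by (intro neg_expansion_eqI)
  qed (simp add: xs(4))
  moreover have "seifert_data n a = (e\<^sub>0, b)"
    by (rule seifert_data_eqI[OF a data])
  ultimately show ?thesis
    by (simp add: seifert_plumbing_def)
qed

section \<open>The vertex added to the n-th leg\<close>

locale seifert_twist =
  S: seifert_star n a e\<^sub>0 b xs
  for n :: nat and a :: "nat \<Rightarrow> int" and e\<^sub>0 b xs +
  fixes a' b' x :: int and \<alpha> :: int
  assumes n: "n \<in> {1..n}"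
    and \<alpha>: "\<alpha> = cofactor n a n"
    and a': "a' = a n + \<alpha>"
    and adjacent: "a n * b' - b n * a' = 1"
    and x: "2 \<le> x"
    and tail_num_0': "tail_num (xs n @ [x]) 0 = a'"
    and tail_num_1': "tail_num (xs n @ [x]) 1 = b'"
begin

abbreviation "ys \<equiv> xs(n := xs n @ [x])"

abbreviation "\<Gamma>' \<equiv> star_plumbing e\<^sub>0 n ys"

text \<open>Designed for orthogonality: on the other legs the numerators are scaled to the value
  \<alpha> = a' - a_n that the difference on leg n takes at the centre. Multiplied by \<alpha>, it
  is the vector \<open>central\<close> of the larger star minus that of the smaller one.\<close>

definition new_generator :: "star_vertex \<Rightarrow> int" where
  "new_generator = star_vector n ys \<alpha> (\<lambda>i j.
     if i = n then tail_num (ys n) j - tail_num (xs n) j else (\<alpha> div a i) * tail_num (xs i) j)"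

lemma \<alpha>_div: "i \<in> {1..n} \<Longrightarrow> i \<noteq> n \<Longrightarrow> \<alpha> div a i * a i = \<alpha>"
  using dvd_cofactor[of i n n a] by (simp add: \<alpha>)

lemma cofactor_eq: "i \<in> {1..n} \<Longrightarrow> i \<noteq> n \<Longrightarrow> cofactor n a i = \<alpha> div a i * a n"
proof -
  assume i: "i \<in> {1..n}" "i \<noteq> n"
  have "cofactor n a i * a i = \<alpha> * a n"
    unfolding cofactor_mult[OF i(1)] \<alpha> cofactor_mult[OF n] ..
  also have "\<dots> = (\<alpha> div a i * a i) * a n"
    by (simp only: \<alpha>_div[OF i])
  finally have "cofactor n a i * a i = (\<alpha> div a i * a n) * a i"
    by (simp only: mult_ac)
  then show ?thesis
    using S.a_ge_2[OF i(1)] by simp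
qed

lemma b'_minus_b: "a n * (b' - b n) = \<alpha> * b n + 1"
  using adjacent by (simp add: a' algebra_simps)

text \<open>Orthogonality of \<open>new_generator\<close> to the centre. After multiplication by
  \<open>a n\<close> it is the Seifert equation, whose -1 is cancelled by the 1 in
  \<open>b'_minus_b\<close>.\<close>

lemma centre_sum:
  "e\<^sub>0 * \<alpha> + (\<Sum>i\<in>{1..n} - {n}. (\<alpha> div a i) * b i) + (b' - b n) = 0"
proof -
  have "(\<Sum>i=1..n. cofactor n a i * b i)
      = \<alpha> * b n + a n * (\<Sum>i\<in>{1..n} - {n}. (\<alpha> div a i) * b i)"
    unfolding sum.remove[OF finite_atLeastAtMost n] sum_distrib_left
    by (intro arg_cong2[of _ _ _ _ "(+)"] sum.cong) (auto simp: \<alpha>[symmetric] cofactor_eq)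
  then have "a n * (e\<^sub>0 * \<alpha> + (\<Sum>i\<in>{1..n} - {n}. (\<alpha> div a i) * b i) + (b' - b n)) = 0"
    using S.seifert b'_minus_b unfolding cofactor_mult[OF n, symmetric] \<alpha>[symmetric]
    by (simp add: algebra_simps)
  then show ?thesis
    using S.a_ge_2[OF n] by simp
qed

lemma ys_nonempty: "i \<in> {1..n} \<Longrightarrow> ys i \<noteq> []"
  using S.xs_nonempty by simp

lemma tail_num_ys_length: "tail_num (xs n @ [x]) (Suc (length (xs n))) = 1"
  using tail_num_length[of "xs n @ [x]"] by simp

lemma vertex_pairing_new_generator:
  assumes "v \<in> verts \<Gamma>'"
  shows "vertex_pairing \<Gamma>' (to_rat new_generator) v
    = (if v = Leg n (Suc (length (xs n))) then - 1 else 0)"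
proof (cases v)
  case Centre
  let ?f = "\<lambda>i. if i = n then tail_num (ys n) 1 - tail_num (xs n) 1 else (\<alpha> div a i) * tail_num (xs i) 1"
  have "(\<Sum>i=1..n. ?f i) = (b' - b n) + (\<Sum>i\<in>{1..n} - {n}. (\<alpha> div a i) * b i)"
    unfolding sum.remove[OF finite_atLeastAtMost n]
    using tail_num_1' S.tail_num_1[OF n] S.tail_num_1
    by (intro arg_cong2[of _ _ _ _ "(+)"] sum.cong) auto
  then have "e\<^sub>0 * \<alpha> + (\<Sum>i=1..n. ?f i) = 0"
    using centre_sum by linarith
  then show ?thesis
    unfolding Centre new_generator_def
    by (subst vertex_pairing_star_vector_Centre[OF ys_nonempty]) (simp_all del: fun_upd_apply)
next
  case (Leg i j)
  with assms have i: "i \<in> {1..n}" and j: "1 \<le> j" "j \<le> length (ys i)"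
    by (auto simp: Leg_in_star simp del: fun_upd_apply)
  show ?thesis
  proof (cases "i = n")
    case True
    have rec': "tail_num (ys n) (j - 1) + tail_num (ys n) (Suc j) = ys n ! (j - 1) * tail_num (ys n) j"
      using tail_num_recurrence[of j "ys n"] j True by simp
    \<comment> \<open>Both sequences satisfy the same recurrence up to the old tip. At the new
      vertex only the last value 1 of the old one is left, which is the origin of the -1 in the
      claim.\<close>
    have rec: "tail_num (xs n) (j - 1) + tail_num (xs n) (Suc j) - ys n ! (j - 1) * tail_num (xs n) j
        = (if j = Suc (length (xs n)) then 1 else 0)"
    proof (cases "j \<le> length (xs n)")
      case True
      moreover from this j(1) have "j - 1 < length (xs n)"
        by simp
      ultimately show ?thesis
        using tail_num_recurrence[of j "xs n"] j(1) by (simp add: nth_append)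
    next
      case False
      with j(2) \<open>i = n\<close> have "j = Suc (length (xs n))"
        by simp
      then show ?thesis
        by (simp add: tail_num_beyond)
    qed
    have "(tail_num (ys n) (j - 1) - tail_num (xs n) (j - 1))
        + (tail_num (ys n) (Suc j) - tail_num (xs n) (Suc j))
        - ys n ! (j - 1) * (tail_num (ys n) j - tail_num (xs n) j)
        = (if j = Suc (length (xs n)) then - 1 else 0)"
      using rec' rec by (simp add: algebra_simps split: if_splits)
    moreover have "tail_num (ys n) 0 - tail_num (xs n) 0 = \<alpha>"
      using tail_num_0' S.tail_num_0[OF n] a' by simp
    moreover have "tail_num (ys n) (Suc (length (ys n))) - tail_num (xs n) (Suc (length (ys n))) = 0"
      by (simp add: tail_num_beyond)
    ultimately show ?thesis
      unfolding Leg new_generator_def using i j True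
      by (subst vertex_pairing_star_vector_Leg) (simp_all del: fun_upd_apply)
  next
    case False
    then have j': "j \<le> length (xs i)" "ys i = xs i"
      using j(2) by simp_all
    have "(\<alpha> div a i) * tail_num (xs i) (j - 1) + (\<alpha> div a i) * tail_num (xs i) (Suc j)
        - ys i ! (j - 1) * ((\<alpha> div a i) * tail_num (xs i) j) = 0"
      using tail_num_recurrence[OF j(1) j'(1)] unfolding j'(2) by algebra
    moreover have "\<alpha> div a i * tail_num (xs i) 0 = \<alpha>"
      using \<alpha>_div[OF i False] S.tail_num_0[OF i] by simp
    moreover have "\<alpha> div a i * tail_num (xs i) (Suc (length (ys i))) = 0"
      by (simp add: tail_num_beyond j'(2) del: fun_upd_apply)
    ultimately show ?thesis
      unfolding Leg new_generator_def using i j False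
      by (subst vertex_pairing_star_vector_Leg) (simp_all del: fun_upd_apply)
  qed
qed

lemma blowup: "plumbing_blowup S.\<Gamma> \<Gamma>' (Leg n (Suc (length (xs n)))) new_generator"
proof (intro plumbing_blowup.intro plumbing_blowup_axioms.intro plumbing_lattice_star)
  let ?v = "Leg n (Suc (length (xs n)))"
  have in_iff: "u \<in> verts \<Gamma>' \<longleftrightarrow> u = ?v \<or> u \<in> verts S.\<Gamma>" for u
    using n by (cases u) (auto simp: Centre_in_star Leg_in_star)
  then show "verts \<Gamma>' = insert ?v (verts S.\<Gamma>)"
    by blast
  show v_new: "?v \<notin> verts S.\<Gamma>"
    by (simp add: Leg_in_star)
  show "pairing \<Gamma>' u u' = pairing S.\<Gamma> u u'" if "u \<in> verts S.\<Gamma>" "u' \<in> verts S.\<Gamma>" for u u'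
    using that by (auto simp: pairing_def star_plumbing_def nth_append split: star_vertex.split)
  show "new_generator \<in> lattice_of \<Gamma>'"
    unfolding new_generator_def by (rule star_vector_lattice)
  show "new_generator ?v = 1"
    using n tail_num_ys_length by (simp add: new_generator_def star_vector_def tail_num_beyond)
  show "vertex_pairing \<Gamma>' (to_rat new_generator) u = 0" if "u \<in> verts S.\<Gamma>" for u
    using that v_new in_iff by (subst vertex_pairing_new_generator) auto
  show "vertex_pairing \<Gamma>' (to_rat new_generator) ?v = - 1"
    using in_iff by (subst vertex_pairing_new_generator) auto
qed

lemma d_invariant_twist: "d_invariant S.\<Gamma> = d_invariant \<Gamma>'"
  by (rule plumbing_blowup.d_invariant_extended[OF blowup S.neg_definite_star S.unimodular_star])

end

text \<open>Why \<open>e\<^sub>0\<close> survives, in the letters of the proof: A times the new left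
  side is C + A' (-1 - e A C), by A B' = 1 + B A' and the old equation, and A' = A + C turns this
  into A (-1 - e A' C).\<close>

lemma is_seifert_data_twist:
  fixes a b :: "nat \<Rightarrow> int"
  assumes a: "\<And>i. i \<in> {1..n} \<Longrightarrow> a i \<ge> 2" and n: "n \<in> {1..n}"
    and data: "is_seifert_data n a e\<^sub>0 b"
    and b': "1 \<le> b'" "b' < a n + cofactor n a n"
    and adjacent: "a n * b' - b n * (a n + cofactor n a n) = 1"
  defines "a' \<equiv> a(n := a n + cofactor n a n)"
  shows "is_seifert_data n a' e\<^sub>0 (b(n := b'))"
proof -
  let ?\<alpha> = "cofactor n a n"
  let ?b = "b(n := b')"
  have pos: "0 < ?\<alpha>"
    unfolding cofactor_def using a by (force intro!: prod_pos)
  have same: "(\<Sum>i\<in>{1..n} - {n}. rat_of_int (?b i) / of_int (a' i))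
      = (\<Sum>i\<in>{1..n} - {n}. rat_of_int (b i) / of_int (a i))"
    by (intro sum.cong) (auto simp: a'_def)
  have prod: "(\<Prod>j=1..n. a j) = a n * ?\<alpha>" "(\<Prod>j=1..n. a' j) = (a n + ?\<alpha>) * ?\<alpha>"
    unfolding prod.remove[OF finite_atLeastAtMost n]
    by (auto simp: cofactor_def a'_def intro!: prod.cong)
  define A B A' B' C T e where "A = rat_of_int (a n)" and "B = rat_of_int (b n)"
    and "A' = rat_of_int (a n + ?\<alpha>)" and "B' = rat_of_int b'" and "C = rat_of_int ?\<alpha>"
    and "T = (\<Sum>i\<in>{1..n} - {n}. rat_of_int (b i) / of_int (a i))" and "e = rat_of_int e\<^sub>0"
  have nz: "A \<noteq> 0" "A' \<noteq> 0" "C \<noteq> 0" and A': "A' = A + C"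
    using a[OF n] pos by (auto simp: A_def A'_def C_def)
  have adj: "A * B' - B * A' = 1"
    using arg_cong[OF adjacent, of rat_of_int] by (simp add: A_def B_def A'_def B'_def)
  have "(B / A + T) * (A * C) = - 1 - e * (A * C)"
    using data unfolding is_seifert_data_def sum.remove[OF finite_atLeastAtMost n] prod
    by (simp add: A_def B_def C_def T_def e_def)
  moreover have "(B / A + T) * (A * C) = B * C + T * (A * C)"
    using nz by (simp add: distrib_right)
  ultimately have "B * C + T * (A * C) = - 1 - e * (A * C)"
    by simp
  then have "A * ((B' / A' + T) * (A' * C)) = A * (- 1 - e * (A' * C))"
  proof -
    assume eq: "B * C + T * (A * C) = - 1 - e * (A * C)"
    have "A * ((B' / A' + T) * (A' * C)) = (A * B') * C + A' * (T * (A * C))"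
      using nz by (simp add: field_simps)
    also have "A * B' = 1 + B * A'"
      using adj by simp
    also have "T * (A * C) = - 1 - e * (A * C) - B * C"
      using eq by simp
    finally show ?thesis
      by (simp add: A' algebra_simps)
  qed
  then have "(B' / A' + T) * (A' * C) = - 1 - e * (A' * C)"
    by (rule mult_left_cancel[OF nz(1), THEN iffD1])
  moreover have "?b \<in> (\<Pi>\<^sub>E i\<in>{1..n}. {1..<a' i})"
    using data n b' unfolding is_seifert_data_def a'_def by (auto simp: PiE_iff extensional_def)
  ultimately show ?thesis
    unfolding is_seifert_data_def sum.remove[OF finite_atLeastAtMost n] same prod
    by (simp add: A'_def B'_def C_def T_def e_def a'_def)
qed

theorem theorem1p1:
  fixes n :: nat and a :: "nat \<Rightarrow> int" and \<alpha> :: int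
  assumes "n \<ge> 2"
    and "\<And>i. i \<in> {1..n} \<Longrightarrow> a i \<ge> 2"
    and "pairwise (\<lambda>i j. coprime (a i) (a j)) {1..n}"
    and "\<alpha> = (\<Prod>i=1..n-1. a i)"
  shows "d_Sigma n a = d_Sigma n (a(n := a n + \<alpha>))"
proof -
  note a = assms(2,3)
  have n: "n \<in> {1..n}"
    using assms(1) by simp
  have "{1..n} - {n} = {1..n - 1}"
    using assms(1) by auto
  then have \<alpha>: "\<alpha> = cofactor n a n"
    by (simp add: assms(4) cofactor_def)
  have \<alpha>_pos: "0 < \<alpha>"
    unfolding \<alpha> cofactor_def using a(1) by (force intro!: prod_pos)
  obtain e\<^sub>0 b where data: "is_seifert_data n a e\<^sub>0 b"
    using seifert_data_exists[OF a] by blast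
  have b: "1 \<le> b i" "b i < a i" if "i \<in> {1..n}" for i
    using data that by (auto simp: is_seifert_data_def PiE_iff)
  have residue: "a i dvd cofactor n a i * b i + 1" if "i \<in> {1..n}" for i
    by (rule seifert_residue[OF a(1) data that])
  have ab: "coprime (a i) (b i)" if "i \<in> {1..n}" for i
  proof (rule coprimeI)
    fix d assume "d dvd a i" "d dvd b i"
    then have "d dvd cofactor n a i * b i + 1" "d dvd cofactor n a i * b i"
      using residue[OF that] by auto
    then show "is_unit d"
      by (simp add: dvd_add_right_iff)
  qed
  define a' where "a' = a n + \<alpha>"
  obtain c where c: "\<alpha> * b n + 1 = a n * c"
    using residue[OF n] unfolding \<alpha>[symmetric] by blast
  define b' where "b' = b n + c"
  have adjacent: "a n * b' - b n * a' = 1"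
    using c by (simp add: a'_def b'_def algebra_simps)
  obtain ys x where ys: "\<forall>y\<in>set (ys @ [x]). 2 \<le> y" "tail_num ys 0 = a n" "tail_num ys 1 = b n"
    "tail_num (ys @ [x]) 0 = a'" "tail_num (ys @ [x]) 1 = b'"
    using adjacent_fractions_expansions[OF b[OF n] _ adjacent] \<alpha>_pos by (auto simp: a'_def)
  \<comment> \<open>The range of \<open>b'\<close> is read off the expansion, whose numerators are
    positive and start with a descent from a' to b'.\<close>
  have b': "1 \<le> b'" "b' < a'"
    using tail_num_pos[OF ys(1), of 1] tail_num_decreasing(2)[OF ys(1)] ys by simp_all
  have "\<exists>zs. (\<forall>z\<in>set zs. 2 \<le> z) \<and> tail_num zs 0 = a i \<and> tail_num zs 1 = b i"
    if "i \<in> {1..n}" for i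
    using expansion_exists[OF b[OF that] ab[OF that]] by blast
  then obtain zs where zs: "\<And>i. i \<in> {1..n} \<Longrightarrow> \<forall>z\<in>set (zs i). 2 \<le> z"
    "\<And>i. i \<in> {1..n} \<Longrightarrow> tail_num (zs i) 0 = a i" "\<And>i. i \<in> {1..n} \<Longrightarrow> tail_num (zs i) 1 = b i"
    by metis
  \<comment> \<open>Outside {1..n} the value is the one that \<open>seifert_plumbing\<close> itself
    uses there, as equality of records requires; changing \<open>a\<close> and \<open>b\<close> at
    \<open>n\<close> leaves it alone.\<close>
  define xs where "xs = (\<lambda>i. if i = n then ys else if i \<in> {1..n} then zs i
    else neg_expansion (of_int (a i) / of_int (b i)))"
  have xs: "\<forall>y\<in>set (xs i). 2 \<le> y" "tail_num (xs i) 0 = a i" "tail_num (xs i) 1 = b i"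
    if "i \<in> {1..n}" for i
    using that zs ys by (auto simp: xs_def)
  interpret seifert_twist n a e\<^sub>0 b xs a' b' x \<alpha>
  proof
    show "e\<^sub>0 * (\<Prod>j=1..n. a j) + (\<Sum>i=1..n. cofactor n a i * b i) = - 1"
      using data seifert_equation_iff[OF a(1)] by (simp add: is_seifert_data_def)
  qed (use a xs n \<alpha> a'_def adjacent ys in \<open>auto simp: xs_def\<close>)
  have "seifert_plumbing n a = star_plumbing e\<^sub>0 n xs"
    by (rule seifert_plumbing_eq[OF a data xs]) (use n in \<open>auto simp: xs_def\<close>)
  moreover have "seifert_plumbing n (a(n := a')) = star_plumbing e\<^sub>0 n (xs(n := xs n @ [x]))"
  proof (rule seifert_plumbing_eq)
    show "is_seifert_data n (a(n := a')) e\<^sub>0 (b(n := b'))"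
      using is_seifert_data_twist[OF a(1) n data] b' adjacent unfolding a'_def \<alpha> by blast
    \<comment> \<open>\<open>a i\<close> divides \<alpha>, so a' is congruent to \<open>a n\<close>
      modulo \<open>a i\<close>.\<close>
    have "coprime (a i) a'" if "i \<in> {1..n}" "i \<noteq> n" for i
    proof -
      have "a i dvd \<alpha>"
        unfolding \<alpha> using that by (intro dvd_cofactor)
      moreover have "coprime (a i) (a n)"
        using a(2) that n by (auto simp: pairwise_def)
      ultimately show ?thesis
        unfolding a'_def by (metis coprime_iff_gcd_eq_1 dvdE gcd_add_mult mult.commute add.commute)
    qed
    then show "pairwise (\<lambda>i j. coprime ((a(n := a')) i) ((a(n := a')) j)) {1..n}"
      using a(2) by (auto simp: pairwise_def coprime_commute)
    show "\<forall>y\<in>set ((xs(n := xs n @ [x])) i). 2 \<le> y"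
      "tail_num ((xs(n := xs n @ [x])) i) 0 = (a(n := a')) i"
      "tail_num ((xs(n := xs n @ [x])) i) 1 = (b(n := b')) i"
      "2 \<le> (a(n := a')) i" if "i \<in> {1..n}" for i
      using that xs[OF that] ys a(1)[OF that] \<alpha>_pos by (auto simp: xs_def a'_def)
    show "(xs(n := xs n @ [x])) i
        = neg_expansion (of_int ((a(n := a')) i) / of_int ((b(n := b')) i))" if "i \<notin> {1..n}" for i
      using that n by (auto simp: xs_def)
  qed
  ultimately show ?thesis
    unfolding d_Sigma_def a'_def[symmetric] using d_invariant_twist by simp
qed

end
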